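(* Let $V$ and $H$ be finite-dimensional Euclidean spaces with $V\hookrightarrow H$ dense, let $\Sigma$ be a dictionary of $V$, and let $a:V\times V\to\mathbb{R}$ be a symmetric bilinear form. Let $(u_n)_{n\in\mathbb{N}}$ and $(\lambda_n)_{n\in\mathbb{N}}$ be sequences produced either by the PRaGA or by the PReGA (described in the context), let $\lambda:=\lim_{n\to\infty}\lambda_n$ (which exists and is an eigenvalue of $a(\cdot,\cdot)$), and let $F_\lambda$ be the set of $H$-normalized eigenvectors of $a(\cdot,\cdot)$ associated with $\lambda$. Let $K\in\mathbb{R}_+$, $\theta\in(0,1/2]$ and $\varepsilon>0$ be constants such that $$\text{for all } v\in\Omega \text{ such that } \inf_{w\in F_\lambda}\|v-w\|\le\varepsilon,\qquad |\mathcal{J}(v)-\lambda|^{1-\theta}\le K\|\mathcal{J}'(v)\|_*,$$ where $\Omega:=\{v\in V:\ 1/2<\|v\|<3/2\}$ (such constants exist). Then: \begin{enumerate} \item the whole sequence $(u_n)_{n\in\mathbb{N}}$ strongly converges in $V$ to some $w_\lambda\in F_\lambda$; \item the convergence rates are as follows, depending on the value of $\theta$: \begin{itemize} \item if $\theta=1/2$, there exist $C\in\mathbb{R}_+$ and $0<\sigma<1$ such that for all $n\in\mathbb{N}$, $\|u_n-w_\lambda\|_a\le C\sigma^n$; \item if $\theta\in(0,1/2)$, there exists $C\in\mathbb{R}_+$ such that for all $n\in\mathbb{N}^*$, $\|u_n-w_\lambda\|_a\le Cn^{-\frac{\theta}{1-2\theta}}$. \end{itemize} \end{enumerate}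
   Context: $V\subset H$ are real spaces with scalar products $\langle\cdot,\cdot\rangle_V$, $\langle\cdot,\cdot\rangle$ and norms $\|\cdot\|_V$, $\|\cdot\|$ respectively. Constants $\gamma,\nu>0$ are fixed such that $a(v,v)\ge\gamma\|v\|_V^2-\nu\|v\|^2$ for all $v\in V$; set $\langle v,w\rangle_a:=a(v,w)+\nu\langle v,w\rangle$, a scalar product on $V$ with associated norm $\|\cdot\|_a$; $\nu$ is chosen so that $\|v\|_a\ge\|v\|$ for all $v\in V$. Eigenvalues: $\mu\in\mathbb{R}$ is an eigenvalue of $a(\cdot,\cdot)$ with associated eigenvector $\psi\in V\setminus\{0\}$ if $a(\psi,v)=\mu\langle\psi,v\rangle$ for all $v\in V$; $\psi$ is $H$-normalized if $\|\psi\|=1$. Dictionary: $\Sigma\subset V$ is a dictionary of $V$ if (1) $0\in\Sigma$ and $tz\in\Sigma$ for all $(z,t)\in\Sigma\times\mathbb{R}$; (2) $\Sigma$ is weakly closed in $V$; (3) $\mathrm{Span}(\Sigma)$ is dense in $V$. Set $\Sigma^*:=\Sigma\setminus\{0\}$. The injective norm on the dual $V'$ is $\|l\|_*:=\sup_{z\in\Sigma^*}\frac{\langle l,z\rangle_{V',V}}{\|z\|_a}$. Rayleigh quotient: $\mathcal{J}(v):=a(v,v)/\|v\|^2$ for $v\in V\setminus\{0\}$, $\mathcal{J}(0):=+\infty$; $\lambda_\Sigma:=\inf_{z\in\Sigma^*}\mathcal{J}(z)$; $\mathcal{J}'(v)\in V'$ is the derivative of $\mathcal{J}$ at $v$. PRaGA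 (Pure Rayleigh Greedy Algorithm): choose $u_0\in V$ with $\|u_0\|=1$ and $\lambda_0:=a(u_0,u_0)<\lambda_\Sigma$. For $n\ge1$: find $z_n\in\operatorname{argmin}_{z\in\Sigma}\mathcal{J}(u_{n-1}+z)$, and set $u_n:=\frac{u_{n-1}+z_n}{\|u_{n-1}+z_n\|}$, $\lambda_n:=a(u_n,u_n)$. PReGA (Pure Residual Greedy Algorithm): choose $u_0\in V$ with $\|u_0\|=1$ and let $\lambda_0:=a(u_0,u_0)$. For $n\ge1$: find $z_n\in\operatorname{argmin}_{z\in\Sigma}\ \frac12\|u_{n-1}+z\|_a^2-(\lambda_{n-1}+\nu)\langle u_{n-1},z\rangle$, and set $u_n:=\frac{u_{n-1}+z_n}{\|u_{n-1}+z_n\|}$, $\lambda_n:=a(u_n,u_n)$. *)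

theory Defs
  imports "HOL-Analysis.Analysis"
begin

text \<open>
  The spaces \<open>V\<close> and \<open>H\<close> are two Euclidean types, each with its own inner product, and the
  inclusion of \<open>V\<close> in \<open>H\<close> is a linear map \<open>\<iota>\<close>. Thus \<open>norm v\<close> is the norm of \<open>V\<close>, while
  \<open>norm (\<iota> v)\<close> and \<open>\<iota> v \<bullet> \<iota> w\<close> are the norm and the scalar product of \<open>H\<close>.
\<close>

definition dense_embedding :: "('v::euclidean_space \<Rightarrow> 'h::euclidean_space) \<Rightarrow> bool" where
  "dense_embedding \<iota> \<longleftrightarrow> bounded_linear \<iota> \<and> inj \<iota> \<and> closure (range \<iota>) = UNIV"

definition energy_inner ::
  "('v::euclidean_space \<Rightarrow> 'v \<Rightarrow> real) \<Rightarrow> ('v \<Rightarrow> 'h::euclidean_space) \<Rightarrow> real \<Rightarrow> 'v \<Rightarrow> 'v \<Rightarrow> real" where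
  "energy_inner a \<iota> \<nu> v w = a v w + \<nu> * (\<iota> v \<bullet> \<iota> w)"

definition energy_norm ::
  "('v::euclidean_space \<Rightarrow> 'v \<Rightarrow> real) \<Rightarrow> ('v \<Rightarrow> 'h::euclidean_space) \<Rightarrow> real \<Rightarrow> 'v \<Rightarrow> real" where
  "energy_norm a \<iota> \<nu> v = sqrt (energy_inner a \<iota> \<nu> v v)"

definition is_eigenvector ::
  "('v::euclidean_space \<Rightarrow> 'v \<Rightarrow> real) \<Rightarrow> ('v \<Rightarrow> 'h::euclidean_space) \<Rightarrow> real \<Rightarrow> 'v \<Rightarrow> bool" where
  "is_eigenvector a \<iota> \<mu> \<psi> \<longleftrightarrow> \<psi> \<noteq> 0 \<and> (\<forall>v. a \<psi> v = \<mu> * (\<iota> \<psi> \<bullet> \<iota> v))"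

definition is_eigenvalue ::
  "('v::euclidean_space \<Rightarrow> 'v \<Rightarrow> real) \<Rightarrow> ('v \<Rightarrow> 'h::euclidean_space) \<Rightarrow> real \<Rightarrow> bool" where
  "is_eigenvalue a \<iota> \<mu> \<longleftrightarrow> (\<exists>\<psi>. is_eigenvector a \<iota> \<mu> \<psi>)"

definition normalized_eigenvectors ::
  "('v::euclidean_space \<Rightarrow> 'v \<Rightarrow> real) \<Rightarrow> ('v \<Rightarrow> 'h::euclidean_space) \<Rightarrow> real \<Rightarrow> 'v set" where
  "normalized_eigenvectors a \<iota> \<mu> = {\<psi>. is_eigenvector a \<iota> \<mu> \<psi> \<and> norm (\<iota> \<psi>) = 1}"

definition weak_topology :: "'v::real_normed_vector topology" where
  "weak_topology =
     topology_generated_by {l -` U | (l :: 'v \<Rightarrow> real) U. bounded_linear l \<and> open U}"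

definition dictionary :: "'v::real_normed_vector set \<Rightarrow> bool" where
  "dictionary \<Sigma> \<longleftrightarrow>
     0 \<in> \<Sigma> \<and> (\<forall>z\<in>\<Sigma>. \<forall>t::real. t *\<^sub>R z \<in> \<Sigma>) \<and>
     closedin weak_topology \<Sigma> \<and>
     closure (span \<Sigma>) = UNIV"

text \<open>
  For a linear functional \<open>l\<close> on the finite-dimensional space \<open>V\<close> and a coercive energy norm, the
  set of quotients is bounded, so that the real-valued supremum is the intended one.
\<close>

definition injective_norm ::
  "('v::euclidean_space \<Rightarrow> 'v \<Rightarrow> real) \<Rightarrow> ('v \<Rightarrow> 'h::euclidean_space) \<Rightarrow> real \<Rightarrow> 'v set \<Rightarrow>
   ('v \<Rightarrow> real) \<Rightarrow> real" where
  "injective_norm a \<iota> \<nu> \<Sigma> l = (SUP z \<in> \<Sigma> - {0}. l z / energy_norm a \<iota> \<nu> z)"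

text \<open>
  \<open>rayleigh_quotient\<close> is only meaningful away from \<open>0\<close>; \<open>rayleigh\<close> is its extension by \<open>+\<infinity>\<close> at \<open>0\<close>,
  which is the functional minimised by the algorithm.
\<close>

definition rayleigh_quotient ::
  "('v::euclidean_space \<Rightarrow> 'v \<Rightarrow> real) \<Rightarrow> ('v \<Rightarrow> 'h::euclidean_space) \<Rightarrow> 'v \<Rightarrow> real" where
  "rayleigh_quotient a \<iota> v = a v v / (norm (\<iota> v))\<^sup>2"

definition rayleigh ::
  "('v::euclidean_space \<Rightarrow> 'v \<Rightarrow> real) \<Rightarrow> ('v \<Rightarrow> 'h::euclidean_space) \<Rightarrow> 'v \<Rightarrow> ereal" where
  "rayleigh a \<iota> v = (if v = 0 then \<infinity> else ereal (rayleigh_quotient a \<iota> v))"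

definition rayleigh_deriv ::
  "('v::euclidean_space \<Rightarrow> 'v \<Rightarrow> real) \<Rightarrow> ('v \<Rightarrow> 'h::euclidean_space) \<Rightarrow> 'v \<Rightarrow> 'v \<Rightarrow> real" where
  "rayleigh_deriv a \<iota> v = frechet_derivative (rayleigh_quotient a \<iota>) (at v)"

definition dictionary_inf ::
  "('v::euclidean_space \<Rightarrow> 'v \<Rightarrow> real) \<Rightarrow> ('v \<Rightarrow> 'h::euclidean_space) \<Rightarrow> 'v set \<Rightarrow> ereal" where
  "dictionary_inf a \<iota> \<Sigma> = (INF z \<in> \<Sigma> - {0}. rayleigh a \<iota> z)"

text \<open>
  In both algorithms \<open>u n + z\<close> is nonzero for every admissible minimiser \<open>z\<close> (compare with the
  competitor \<open>z = 0\<close>), so the normalisation never divides by zero.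
\<close>

definition PRaGA ::
  "('v::euclidean_space \<Rightarrow> 'v \<Rightarrow> real) \<Rightarrow> ('v \<Rightarrow> 'h::euclidean_space) \<Rightarrow> 'v set \<Rightarrow>
   (nat \<Rightarrow> 'v) \<Rightarrow> (nat \<Rightarrow> real) \<Rightarrow> bool" where
  "PRaGA a \<iota> \<Sigma> u lam \<longleftrightarrow>
     norm (\<iota> (u 0)) = 1 \<and>
     (\<forall>n. lam n = a (u n) (u n)) \<and>
     ereal (lam 0) < dictionary_inf a \<iota> \<Sigma> \<and>
     (\<forall>n. \<exists>z. is_arg_min (\<lambda>z. rayleigh a \<iota> (u n + z)) (\<lambda>z. z \<in> \<Sigma>) z \<and>
              u (Suc n) = (u n + z) /\<^sub>R norm (\<iota> (u n + z)))"

definition PReGA ::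
  "('v::euclidean_space \<Rightarrow> 'v \<Rightarrow> real) \<Rightarrow> ('v \<Rightarrow> 'h::euclidean_space) \<Rightarrow> real \<Rightarrow> 'v set \<Rightarrow>
   (nat \<Rightarrow> 'v) \<Rightarrow> (nat \<Rightarrow> real) \<Rightarrow> bool" where
  "PReGA a \<iota> \<nu> \<Sigma> u lam \<longleftrightarrow>
     norm (\<iota> (u 0)) = 1 \<and>
     (\<forall>n. lam n = a (u n) (u n)) \<and>
     (\<forall>n. \<exists>z. is_arg_min
                (\<lambda>z. 1/2 * (energy_norm a \<iota> \<nu> (u n + z))\<^sup>2 - (lam n + \<nu>) * (\<iota> (u n) \<bullet> \<iota> z))
                (\<lambda>z. z \<in> \<Sigma>) z \<and>
              u (Suc n) = (u n + z) /\<^sub>R norm (\<iota> (u n + z)))"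

definition lojasiewicz ::
  "('v::euclidean_space \<Rightarrow> 'v \<Rightarrow> real) \<Rightarrow> ('v \<Rightarrow> 'h::euclidean_space) \<Rightarrow> real \<Rightarrow> 'v set \<Rightarrow>
   real \<Rightarrow> real \<Rightarrow> real \<Rightarrow> real \<Rightarrow> bool" where
  "lojasiewicz a \<iota> \<nu> \<Sigma> \<mu> K \<theta> \<epsilon> \<longleftrightarrow>
     (\<forall>v. 1/2 < norm (\<iota> v) \<and> norm (\<iota> v) < 3/2 \<and>
          (INF w \<in> normalized_eigenvectors a \<iota> \<mu>. norm (\<iota> v - \<iota> w)) \<le> \<epsilon> \<longrightarrow>
          \<bar>rayleigh_quotient a \<iota> v - \<mu>\<bar> powr (1 - \<theta>)
            \<le> K * injective_norm a \<iota> \<nu> \<Sigma> (rayleigh_deriv a \<iota> v))"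

end

theory Submission
  imports Defs
begin

text \<open>
  In finite dimension \<open>\<iota>\<close> is an isomorphism, so everything may be read on \<open>H\<close>, where
  \<open>a(v, w) = \<iota> v \<bullet> A (\<iota> w)\<close> with \<open>A\<close> selfadjoint. Both algorithms then satisfy the same two
  estimates: with \<open>d\<^sub>n = \<lambda>\<^sub>n - \<lambda>\<^sub>n\<^sub>+\<^sub>1 \<ge> 0\<close>, the step \<open>u\<^sub>n\<^sub>+\<^sub>1 - u\<^sub>n\<close> and the residual
  \<open>A u\<^sub>n - \<lambda>\<^sub>n u\<^sub>n\<close>, tested on the dictionary, are \<open>O(\<surd>d\<^sub>n)\<close>. For the residual algorithm this is the
  Euler equation for \<open>z\<^sub>n\<close>; for the Rayleigh algorithm the form \<open>b = a - \<lambda>\<^sub>n\<^sub>+\<^sub>1 \<langle>\<cdot>,\<cdot>\<rangle>\<close> is nonnegative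
  at every \<open>u\<^sub>n + t z\<close> with \<open>z\<close> in the dictionary, so the residual is bounded by a discriminant, and \<open>d\<^sub>n = b(z\<^sub>n, z\<^sub>n)\<close>.

  Hence limit points are eigenvectors, and close to them the Lojasiewicz inequality reads
  \<open>e\<^sub>n powr (1 - \<theta>) \<le> K \<surd>(e\<^sub>n - e\<^sub>n\<^sub>+\<^sub>1)\<close> for \<open>e\<^sub>n = \<lambda>\<^sub>n - \<lambda>\<close>. By concavity \<open>\<surd>d\<^sub>n\<close> is bounded by a
  multiple of \<open>e\<^sub>n powr \<theta> - e\<^sub>n\<^sub>+\<^sub>1 powr \<theta>\<close>, so the steps are summable with tail \<open>O(e\<^sub>n powr \<theta>)\<close>, and the
  same inequality gives the decay of \<open>e\<^sub>n\<close>.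
\<close>

section \<open>Real sequences under a Lojasiewicz inequality\<close>

text \<open>A concave power lies below its tangent at \<open>x\<close>. By homogeneity only the
  ratio \<open>y / x\<close> matters, and for it the tangent bound at 1 is Young's inequality with
  weights \<open>\<theta>\<close> and \<open>1 - \<theta>\<close>. This route also covers
  \<open>y = 0\<close>.\<close>

lemma powr_diff_ge_concave:
  fixes x y \<theta> :: real
  assumes "0 < x" "0 \<le> y" "0 < \<theta>" "\<theta> \<le> 1"
  shows "\<theta> * x powr (\<theta> - 1) * (x - y) \<le> x powr \<theta> - y powr \<theta>"
proof -
  have "(y / x) powr \<theta> \<le> \<theta> * (y / x) + (1 - \<theta>)"
    using assms Youngs_inequality_0[of \<theta> "1 - \<theta>" "y / x" 1] by (cases "y = 0") auto
  hence "x powr \<theta> * (y / x) powr \<theta> \<le> x powr \<theta> * (\<theta> * (y / x) + (1 - \<theta>))"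
    by (intro mult_left_mono) auto
  moreover have "x powr \<theta> * (y / x) powr \<theta> = y powr \<theta>"
    using assms by (simp flip: powr_mult)
  moreover have "x powr \<theta> * (\<theta> * (y / x) + (1 - \<theta>)) = x powr \<theta> - \<theta> * x powr (\<theta> - 1) * (x - y)"
    using assms by (simp add: powr_diff field_simps)
  ultimately show ?thesis
    by linarith
qed

text \<open>Convex counterpart: a negative power lies above its tangent at \<open>x\<close>. For the
  ratio \<open>y / x\<close> this follows from ln r \<le> r - 1 and 1 + s \<le> exp s.\<close>

lemma powr_minus_diff_ge_convex:
  fixes x y p :: real
  assumes "0 < y" "y \<le> x" "0 < p"
  shows "p * x powr (- p - 1) * (x - y) \<le> y powr (- p) - x powr (- p)"
proof -
  have "p * ln (y / x) \<le> p * (y / x - 1)"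
    using assms ln_le_minus_one[of "y / x"] by (intro mult_left_mono) auto
  hence "p * (1 - y / x) \<le> - p * ln (y / x)"
    by (simp add: algebra_simps)
  also have "\<dots> \<le> exp (- p * ln (y / x)) - 1"
    using exp_ge_add_one_self[of "- p * ln (y / x)"] by linarith
  also have "\<dots> = (y / x) powr (- p) - 1"
    using assms by (simp add: powr_def)
  finally have "x powr (- p) * (p * (1 - y / x)) \<le> x powr (- p) * ((y / x) powr (- p) - 1)"
    by (intro mult_left_mono) auto
  moreover have "x powr (- p) * (y / x) powr (- p) = y powr (- p)"
    using assms by (simp flip: powr_mult)
  moreover have "x powr (- p) * (p * (1 - y / x)) = p * x powr (- p - 1) * (x - y)"
    using assms by (simp add: powr_diff field_simps)
  ultimately show ?thesis
    by (simp add: algebra_simps)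
qed

text \<open>Turns the Lojasiewicz inequality into a telescoping bound: the hypothesis replaces one
  factor \<open>sqrt (x - y)\<close> by \<open>x powr (1 - \<theta>)\<close>, which cancels the
  factor \<open>x powr (\<theta> - 1)\<close> of the tangent inequality.\<close>

lemma sqrt_diff_le_powr_diff:
  fixes x y \<theta> K :: real
  assumes "0 \<le> y" "y \<le> x" "0 < \<theta>" "\<theta> \<le> 1" "x powr (1 - \<theta>) \<le> K * sqrt (x - y)"
  shows "\<theta> * sqrt (x - y) \<le> K * (x powr \<theta> - y powr \<theta>)"
proof (cases "x = y")
  case False
  hence "0 < x" "0 < x - y"
    using assms by auto
  \<comment> \<open>The sign of \<open>K\<close> is not assumed; the hypothesis forces it once
    \<open>x\<close> is positive.\<close>
  have "0 < K * sqrt (x - y)"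
    using assms(5) \<open>0 < x\<close> by (smt (verit) powr_gt_zero)
  hence "0 < K"
    using \<open>0 < x - y\<close> by (simp add: zero_less_mult_iff)
  have "x powr (1 - \<theta>) * x powr (\<theta> - 1) = 1"
    using \<open>0 < x\<close> by (simp flip: powr_add)
  hence "\<theta> * sqrt (x - y) = x powr (1 - \<theta>) * (\<theta> * x powr (\<theta> - 1) * sqrt (x - y))"
    by (simp add: algebra_simps)
  also have "\<dots> \<le> K * sqrt (x - y) * (\<theta> * x powr (\<theta> - 1) * sqrt (x - y))"
    using assms by (intro mult_right_mono) auto
  also have "\<dots> = K * (\<theta> * x powr (\<theta> - 1) * (x - y))"
    using \<open>0 < x - y\<close> by simp
  also have "\<dots> \<le> K * (x powr \<theta> - y powr \<theta>)"
    using powr_diff_ge_concave assms \<open>0 < x\<close> \<open>0 < K\<close> by (intro mult_left_mono) auto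
  finally show ?thesis .
qed auto

text \<open>Finitely many early indices only enlarge the constant, because \<open>g\<close> is
  positive there: add the absolute ratios \<open>f n / g n\<close> for \<open>n\<close> below
  \<open>N\<close>.\<close>

lemma eventually_le_imp_le_from:
  fixes f g :: "nat \<Rightarrow> real"
  assumes "\<And>n. n \<ge> k \<Longrightarrow> 0 < g n" "\<And>n. n \<ge> N \<Longrightarrow> f n \<le> C * g n"
  shows "\<exists>C'\<ge>0. \<forall>n\<ge>k. f n \<le> C' * g n"
proof -
  define D where "D = \<bar>C\<bar> + (\<Sum>n\<in>{k..<N}. \<bar>f n / g n\<bar>)"
  have "D \<ge> 0"
    unfolding D_def by (intro add_nonneg_nonneg sum_nonneg) auto
  moreover have "f n \<le> D * g n" if "n \<ge> k" for n
  proof (cases "n \<ge> N")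
    case True
    have "C \<le> D"
      unfolding D_def by (smt (verit) abs_ge_zero sum_nonneg)
    thus ?thesis
      using assms(2)[OF True] assms(1)[OF that] by (smt (verit) mult_right_mono)
  next
    case False
    have "\<bar>f n / g n\<bar> \<le> (\<Sum>n\<in>{k..<N}. \<bar>f n / g n\<bar>)"
      using False that by (intro member_le_sum) auto
    hence "f n / g n \<le> D"
      unfolding D_def by linarith
    thus ?thesis
      using assms(1)[OF that] by (simp add: field_simps)
  qed
  ultimately show ?thesis by blast
qed

lemma decay_geometric:
  fixes e :: "nat \<Rightarrow> real"
  assumes pos: "\<And>n. 0 \<le> e n"
    and step: "\<And>n. n \<ge> N \<Longrightarrow> e n \<le> K * (e n - e (Suc n))"
    and dec: "\<And>n. e (Suc n) \<le> e n"
  shows "\<exists>C \<sigma>. 0 \<le> C \<and> 0 < \<sigma> \<and> \<sigma> < 1 \<and> (\<forall>n. e n \<le> C * \<sigma> ^ n)"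
proof -
  \<comment> \<open>Enlarging \<open>K\<close> is harmless since the drops are nonnegative; the
    value 2 keeps the ratio \<open>1 - 1 / K'\<close> strictly between 0 and 1.\<close>
  define K' where "K' = max K 2"
  define \<sigma> where "\<sigma> = 1 - 1 / K'"
  have "K' \<ge> 2" "K \<le> K'"
    unfolding K'_def by auto
  hence \<sigma>: "0 < \<sigma>" "\<sigma> < 1"
    unfolding \<sigma>_def by (auto simp: field_simps)
  have *: "e (Suc n) \<le> \<sigma> * e n" if "n \<ge> N" for n
  proof -
    have "e n \<le> K' * (e n - e (Suc n))"
      using step[OF that] mult_right_mono[OF \<open>K \<le> K'\<close>, of "e n - e (Suc n)"] dec[of n] by linarith
    thus ?thesis
      using \<open>K' \<ge> 2\<close> unfolding \<sigma>_def by (simp add: field_simps)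
  qed
  have "e n \<le> (e N / \<sigma> ^ N) * \<sigma> ^ n" if "n \<ge> N" for n
    using that
  proof (induction n rule: dec_induct)
    case base
    show ?case using \<sigma> by simp
  next
    case (step n)
    have "e (Suc n) \<le> \<sigma> * ((e N / \<sigma> ^ N) * \<sigma> ^ n)"
      using *[OF step.hyps(1)] step.IH \<sigma> by (smt (verit) mult_left_mono)
    thus ?case by (simp add: algebra_simps)
  qed
  from eventually_le_imp_le_from[where k = 0 and N = N and f = e and g = "\<lambda>n. \<sigma> ^ n", OF _ this] \<sigma>
  show ?thesis by auto
qed

text \<open>Discrete form of the differential inequality e' \<le> - e^(1+p) / K: the quantity
  \<open>e n powr (- p)\<close> grows by at least a fixed \<open>c\<close> per step, hence at least
  linearly, and inverting the power gives the rate.\<close>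

lemma decay_polynomial:
  fixes e :: "nat \<Rightarrow> real"
  assumes pos: "\<And>n. 0 \<le> e n"
    and step: "\<And>n. n \<ge> N \<Longrightarrow> e n powr (1 + p) \<le> K * (e n - e (Suc n))"
    and dec: "\<And>n. e (Suc n) \<le> e n"
    and p: "0 < p"
  shows "\<exists>C\<ge>0. \<forall>n\<ge>1. e n \<le> C * real n powr (- (1 / p))"
proof -
  define K' where "K' = max K 1"
  define c where "c = p / K'"
  have "K' \<ge> 1" "K \<le> K'"
    unfolding K'_def by auto
  hence "c > 0"
    unfolding c_def using p by auto
  have dec': "e n \<le> e m" if "m \<le> n" for m n
    using lift_Suc_antimono_le[of e m n] dec that by auto
  \<comment> \<open>Positivity of the later term is essential, since \<open>0 powr (- p)\<close> is
    0 by convention; by monotonicity it also gives positivity of the earlier one.\<close>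
  have *: "c \<le> e (Suc n) powr (- p) - e n powr (- p)" if "n \<ge> N" "e (Suc n) > 0" for n
  proof -
    have "e n > 0"
      using that dec[of n] by linarith
    have "e n powr (1 + p) \<le> K' * (e n - e (Suc n))"
      using step[OF that(1)] mult_right_mono[OF \<open>K \<le> K'\<close>, of "e n - e (Suc n)"] dec[of n] by linarith
    hence "e n powr (1 + p) * e n powr (- p - 1) \<le> K' * (e n - e (Suc n)) * e n powr (- p - 1)"
      by (intro mult_right_mono) auto
    also have "e n powr (1 + p) * e n powr (- p - 1) = 1"
      using \<open>e n > 0\<close> by (simp flip: powr_add)
    finally have "p \<le> p * (K' * (e n - e (Suc n)) * e n powr (- p - 1))"
      using p by simp
    hence "c \<le> p * e n powr (- p - 1) * (e n - e (Suc n))"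
      using \<open>K' \<ge> 1\<close> unfolding c_def by (simp add: field_simps)
    also have "\<dots> \<le> e (Suc n) powr (- p) - e n powr (- p)"
      using powr_minus_diff_ge_convex that dec p by blast
    finally show ?thesis .
  qed
  have **: "c * (real n - real N) \<le> e n powr (- p)" if "n \<ge> N" "e n > 0" for n
    using that
  proof (induction n rule: dec_induct)
    case (step n)
    have "e n > 0"
      using step.prems dec[of n] by linarith
    thus ?case
      using * step by (fastforce simp: algebra_simps)
  qed auto
  \<comment> \<open>From \<open>2 * N + 1\<close> on, \<open>n - N\<close> is at least
    \<open>n / 2\<close>, which absorbs the shift into the constant.\<close>
  have "e n \<le> (c / 2) powr (- (1 / p)) * real n powr (- (1 / p))" if "n \<ge> 2 * N + 1" for n
  proof (cases "e n = 0")
    case False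
    hence "e n > 0"
      using pos[of n] by linarith
    have "c / 2 * real n \<le> c * (real n - real N)"
      using that \<open>c > 0\<close> by (simp add: field_simps)
    also have "\<dots> \<le> e n powr (- p)"
      using ** that \<open>e n > 0\<close> by simp
    finally have "(e n powr (- p)) powr (- (1 / p)) \<le> (c / 2 * real n) powr (- (1 / p))"
      using that \<open>c > 0\<close> p by (intro powr_mono2') auto
    moreover have "(e n powr (- p)) powr (- (1 / p)) = e n"
      using \<open>e n > 0\<close> p by (simp add: powr_powr)
    moreover have "(c / 2 * real n) powr (- (1 / p)) = (c / 2) powr (- (1 / p)) * real n powr (- (1 / p))"
      using \<open>c > 0\<close> by (intro powr_mult)
    ultimately show ?thesis
      by simp
  qed auto
  from eventually_le_imp_le_from[where k = 1, OF _ this]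
  show ?thesis by auto
qed

text \<open>The steps are dominated by drops of \<open>e n powr \<theta>\<close>, so the sum of all
  steps after \<open>n\<close> is at most a multiple of \<open>e n powr \<theta>\<close>. The rates
  then reduce to the decay of \<open>e\<close> itself.\<close>

lemma Lojasiewicz_descent_rates:
  fixes u :: "nat \<Rightarrow> 'a::euclidean_space" and e :: "nat \<Rightarrow> real"
  assumes e: "e \<longlonglongrightarrow> 0" and dec: "\<And>n. e (Suc n) \<le> e n"
    and \<theta>: "0 < \<theta>" "\<theta> \<le> 1 / 2"
    and steps: "\<And>n. norm (u (Suc n) - u n) \<le> C * sqrt (e n - e (Suc n))" "0 \<le> C"
    and loj: "\<And>n. n \<ge> N \<Longrightarrow> e n powr (1 - \<theta>) \<le> K * sqrt (e n - e (Suc n))" "0 \<le> K"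
  obtains w where "u \<longlonglongrightarrow> w"
    "\<theta> = 1 / 2 \<Longrightarrow> \<exists>D \<sigma>. 0 \<le> D \<and> 0 < \<sigma> \<and> \<sigma> < 1 \<and> (\<forall>n. norm (u n - w) \<le> D * \<sigma> ^ n)"
    "\<theta> < 1 / 2 \<Longrightarrow> \<exists>D\<ge>0. \<forall>n\<ge>1. norm (u n - w) \<le> D * real n powr (- (\<theta> / (1 - 2 * \<theta>)))"
proof -
  have mono: "e n \<le> e m" if "m \<le> n" for m n
    using lift_Suc_antimono_le[of e m n] dec that by auto
  have pos: "0 \<le> e n" for n
    using decseq_ge[OF _ e] mono by (auto simp: decseq_def)
  define B where "B = C * K / \<theta>"
  have "B \<ge> 0"
    unfolding B_def using loj(2) steps(2) \<theta> by auto
  have step': "norm (u (Suc n) - u n) \<le> B * (e n powr \<theta> - e (Suc n) powr \<theta>)" if "n \<ge> N" for n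
  proof -
    have "\<theta> * sqrt (e n - e (Suc n)) \<le> K * (e n powr \<theta> - e (Suc n) powr \<theta>)"
      using \<theta> by (intro sqrt_diff_le_powr_diff loj that pos dec) auto
    hence "sqrt (e n - e (Suc n)) \<le> K * (e n powr \<theta> - e (Suc n) powr \<theta>) / \<theta>"
      using \<theta> by (simp add: field_simps)
    hence "C * sqrt (e n - e (Suc n)) \<le> C * (K * (e n powr \<theta> - e (Suc n) powr \<theta>) / \<theta>)"
      using steps(2) by (intro mult_left_mono)
    thus ?thesis
      using steps(1)[of n] unfolding B_def by simp
  qed
  have tele: "norm (u m - u n) \<le> B * (e n powr \<theta> - e m powr \<theta>)" if "N \<le> n" "n \<le> m" for m n
    using that(2)
  proof (induction m rule: dec_induct)
    case (step m)
    have "norm (u (Suc m) - u n) \<le> norm (u (Suc m) - u m) + norm (u m - u n)"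
      using norm_triangle_ineq[of "u (Suc m) - u m" "u m - u n"] by simp
    also have "\<dots> \<le> B * (e m powr \<theta> - e (Suc m) powr \<theta>) + B * (e n powr \<theta> - e m powr \<theta>)"
      using step that by (intro add_mono step') auto
    finally show ?case by (simp add: algebra_simps)
  qed auto
  have tail: "norm (u m - u n) \<le> B * e n powr \<theta>" if "N \<le> n" "n \<le> m" for m n
  proof -
    have "B * (e n powr \<theta> - e m powr \<theta>) \<le> B * e n powr \<theta>"
      using \<open>B \<ge> 0\<close> by (intro mult_left_mono) auto
    thus ?thesis using tele[OF that] by linarith
  qed
  have lim0: "(\<lambda>n. B * e n powr \<theta>) \<longlonglongrightarrow> 0"
  proof -
    have "(\<lambda>n. e n powr \<theta>) \<longlonglongrightarrow> 0"
      using \<theta> pos by (intro tendsto_zero_powrI[OF e tendsto_const]) auto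
    thus ?thesis by (rule tendsto_mult_right_zero)
  qed
  have "Cauchy u"
    unfolding Cauchy_altdef2
  proof (intro allI impI)
    fix r :: real assume "0 < r"
    with lim0 have "\<forall>\<^sub>F n in sequentially. B * e n powr \<theta> < r"
      by (auto intro: order_tendstoD)
    then obtain M where M: "\<And>n. n \<ge> M \<Longrightarrow> B * e n powr \<theta> < r"
      by (auto simp: eventually_sequentially)
    have "dist (u m) (u (max M N)) < r" if "m \<ge> max M N" for m
      using tail[OF _ that] M[of "max M N"] by (simp add: dist_norm)
    thus "\<exists>M. \<forall>m\<ge>M. dist (u m) (u M) < r"
      by blast
  qed
  then obtain w where w: "u \<longlonglongrightarrow> w"
    using Cauchy_convergent convergent_def by blast
  have rate: "norm (u n - w) \<le> B * e n powr \<theta>" if "n \<ge> N" for n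
  proof -
    have "(\<lambda>m. norm (u m - u n)) \<longlonglongrightarrow> norm (w - u n)"
      by (intro tendsto_intros w)
    moreover have "\<forall>\<^sub>F m in sequentially. norm (u m - u n) \<le> B * e n powr \<theta>"
      using tail[OF that] by (auto simp: eventually_sequentially)
    ultimately have "norm (w - u n) \<le> B * e n powr \<theta>"
      by (intro tendsto_upperbound) auto
    thus ?thesis by (simp add: norm_minus_commute)
  qed
  \<comment> \<open>Squaring removes the root and leaves a recursion for \<open>e\<close> alone. Its
    exponent is 1 exactly for \<theta> = 1/2, which separates geometric from polynomial
    decay.\<close>
  have sq: "e n powr (2 - 2 * \<theta>) \<le> K\<^sup>2 * (e n - e (Suc n))" if "n \<ge> N" for n
  proof -
    have "(e n powr (1 - \<theta>))\<^sup>2 \<le> (K * sqrt (e n - e (Suc n)))\<^sup>2"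
      using loj(1)[OF that] by (intro power_mono) auto
    moreover have "(e n powr (1 - \<theta>))\<^sup>2 = e n powr (2 - 2 * \<theta>)"
      by (simp add: power2_eq_square flip: powr_add)
    moreover have "(K * sqrt (e n - e (Suc n)))\<^sup>2 = K\<^sup>2 * (e n - e (Suc n))"
      using dec[of n] by (simp add: power_mult_distrib)
    ultimately show ?thesis by simp
  qed
  show ?thesis
  proof
    show "u \<longlonglongrightarrow> w" by fact
  next
    assume "\<theta> = 1 / 2"
    hence "e n \<le> K\<^sup>2 * (e n - e (Suc n))" if "n \<ge> N" for n
      using sq[OF that] pos[of n] unfolding \<open>\<theta> = 1 / 2\<close> by simp
    from decay_geometric[where e = e and N = N, OF pos this dec] obtain D \<sigma> where D: "0 \<le> D" "0 < \<sigma>" "\<sigma> < 1"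
        "\<And>n. e n \<le> D * \<sigma> ^ n"
      by auto
    \<comment> \<open>The distance is governed by the square root of \<open>e n\<close>, so the
      ratio becomes \<open>sqrt \<sigma>\<close>.\<close>
    have "norm (u n - w) \<le> B * sqrt D * sqrt \<sigma> ^ n" if "n \<ge> N" for n
    proof -
      have "e n powr \<theta> \<le> sqrt (D * \<sigma> ^ n)"
        unfolding \<open>\<theta> = 1 / 2\<close> using pos[of n] D by (simp add: powr_half_sqrt)
      also have "\<dots> = sqrt D * sqrt \<sigma> ^ n"
        by (simp add: real_sqrt_mult real_sqrt_power)
      finally have "B * e n powr \<theta> \<le> B * (sqrt D * sqrt \<sigma> ^ n)"
        using \<open>B \<ge> 0\<close> by (intro mult_left_mono)
      thus ?thesis
        using rate[OF that] by simp
    qed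
    from eventually_le_imp_le_from[where k = 0 and N = N and g = "\<lambda>n. sqrt \<sigma> ^ n" and f = "\<lambda>n. norm (u n - w)", OF _ this] D
    obtain D' where "D' \<ge> 0" "\<forall>n. norm (u n - w) \<le> D' * sqrt \<sigma> ^ n"
      by auto
    thus "\<exists>D \<sigma>. 0 \<le> D \<and> 0 < \<sigma> \<and> \<sigma> < 1 \<and> (\<forall>n. norm (u n - w) \<le> D * \<sigma> ^ n)"
      using D by (intro exI[of _ D'] exI[of _ "sqrt \<sigma>"]) auto
  next
    assume "\<theta> < 1 / 2"
    \<comment> \<open>Chosen so that 2 - 2\<theta> = 1 + p; the decay exponent 1/p of
      \<open>e\<close> times \<theta> is the claimed one.\<close>
    define p where "p = 1 - 2 * \<theta>"
    have "p > 0"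
      using \<open>\<theta> < 1 / 2\<close> unfolding p_def by simp
    have "e n powr (1 + p) \<le> K\<^sup>2 * (e n - e (Suc n))" if "n \<ge> N" for n
      using sq[OF that] unfolding p_def by simp
    from decay_polynomial[where e = e and N = N, OF pos this dec \<open>p > 0\<close>] obtain D where
      D: "D \<ge> 0" "\<And>n. n \<ge> 1 \<Longrightarrow> e n \<le> D * real n powr (- (1 / p))"
      by blast
    have "norm (u n - w) \<le> B * D powr \<theta> * real n powr (- (\<theta> / p))" if "n \<ge> max N 1" for n
    proof -
      have "e n powr \<theta> \<le> (D * real n powr (- (1 / p))) powr \<theta>"
        using D that pos \<theta> by (intro powr_mono2) auto
      also have "\<dots> = D powr \<theta> * real n powr (- (\<theta> / p))"
        using D by (simp add: powr_mult powr_powr)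
      finally have "B * e n powr \<theta> \<le> B * (D powr \<theta> * real n powr (- (\<theta> / p)))"
        using \<open>B \<ge> 0\<close> by (intro mult_left_mono)
      thus ?thesis
        using rate[of n] that by simp
    qed
    from eventually_le_imp_le_from[where k = 1 and N = "max N 1" and f = "\<lambda>n. norm (u n - w)"
        and g = "\<lambda>n. real n powr (- (\<theta> / p))", OF _ this]
    show "\<exists>D\<ge>0. \<forall>n\<ge>1. norm (u n - w) \<le> D * real n powr (- (\<theta> / (1 - 2 * \<theta>)))"
      unfolding p_def by auto
  qed
qed

section \<open>Greedy steps for a quadratic form and a spanning cone\<close>

text \<open>Discriminant bound, read off at t = -b/\<alpha>. Allowing an upper bound \<alpha> for
  the leading coefficient makes its sign irrelevant; with c = 0 it forces b = 0, which is how the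
  Euler equations are obtained below.\<close>

lemma quadratic_nonneg_imp:
  fixes a b c :: real
  assumes "\<And>t. 0 \<le> c + 2 * t * b + t\<^sup>2 * a" "a \<le> \<alpha>" "0 < \<alpha>"
  shows "b\<^sup>2 \<le> c * \<alpha>"
proof -
  have "0 \<le> c + 2 * (- b / \<alpha>) * b + (- b / \<alpha>)\<^sup>2 * a"
    using assms(1)[of "- b / \<alpha>"] by simp
  also have "\<dots> \<le> c + 2 * (- b / \<alpha>) * b + (- b / \<alpha>)\<^sup>2 * \<alpha>"
    using assms(2) by (intro add_left_mono mult_left_mono) auto
  also have "\<dots> = (c * \<alpha> - b\<^sup>2) / \<alpha>"
    using assms(3) by (simp add: field_simps power2_eq_square)
  finally show ?thesis
    using assms(3) by (simp add: zero_le_divide_iff)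
qed

text \<open>Normalising moves \<open>u + z\<close> radially by the difference of its norm from 1,
  which is at most \<open>norm z\<close>; adding \<open>z\<close> itself accounts for the factor
  2.\<close>

lemma norm_sgn_add_diff_le:
  fixes u z :: "'a::real_normed_vector"
  assumes "norm u = 1" "u + z \<noteq> 0"
  shows "norm (sgn (u + z) - u) \<le> 2 * norm z"
proof -
  have "norm (sgn (u + z) - (u + z)) = \<bar>norm (u + z) - norm u\<bar>"
  proof -
    have "sgn (u + z) - (u + z) = (1 - norm (u + z)) *\<^sub>R sgn (u + z)"
      using assms by (simp add: sgn_div_norm algebra_simps)
    thus ?thesis
      using assms by (simp add: norm_sgn abs_minus_commute)
  qed
  also have "\<dots> \<le> norm z"
    using norm_triangle_ineq3[of "u + z" u] by simp
  finally show ?thesis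
    using norm_triangle_ineq[of "sgn (u + z) - (u + z)" z] by simp
qed

text \<open>The situation transported to \<open>H\<close>: \<open>A\<close> represents the form,
  \<open>S\<close> is the image of the dictionary, and \<open>coercive\<close> expresses that the
  energy norm dominates the norm of \<open>H\<close>.\<close>

locale spanning_cone_form =
  fixes A :: "'h::euclidean_space \<Rightarrow> 'h" and \<nu> :: real and S :: "'h set"
  assumes linear_A: "linear A"
    and selfadjoint: "A x \<bullet> y = x \<bullet> A y"
    and coercive: "(norm x)\<^sup>2 \<le> x \<bullet> A x + \<nu> * (norm x)\<^sup>2"
    and cone: "z \<in> S \<Longrightarrow> t *\<^sub>R z \<in> S"
    and span_S: "span S = UNIV"
begin

definition energy :: "'h \<Rightarrow> real" where
  "energy x = x \<bullet> A x + \<nu> * (norm x)\<^sup>2"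

definition rq :: "'h \<Rightarrow> real" where
  "rq x = x \<bullet> A x / (norm x)\<^sup>2"

text \<open>The interface between algorithms and convergence proof: both algorithms are shown to
  satisfy it with a constant uniform in \<open>n\<close>, and the convergence argument sees nothing
  else of them. Testing the residual on \<open>S\<close> only is what greedy minimisation can
  provide.\<close>

definition descent_step :: "real \<Rightarrow> 'h \<Rightarrow> 'h \<Rightarrow> bool" where
  "descent_step C u u' \<longleftrightarrow>
     u' \<bullet> A u' \<le> u \<bullet> A u \<and>
     norm (u' - u) \<le> C * sqrt (u \<bullet> A u - u' \<bullet> A u') \<and>
     (\<forall>z\<in>S. \<bar>(A u - (u \<bullet> A u) *\<^sub>R u) \<bullet> z\<bar> \<le> C * sqrt (u \<bullet> A u - u' \<bullet> A u') * norm z)"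

section \<open>Elementary bounds for the form, the energy and the Rayleigh quotient\<close>

lemma A_simps:
  "A (x + y) = A x + A y" "A (x - y) = A x - A y" "A (t *\<^sub>R x) = t *\<^sub>R A x" "A 0 = 0"
  by (simp_all only: linear_add[OF linear_A] linear_diff[OF linear_A] linear_cmul[OF linear_A]
      linear_0[OF linear_A])

lemma S_nonempty: "\<exists>z\<in>S. z \<noteq> 0"
proof (rule ccontr)
  assume "\<not> ?thesis"
  hence "span S \<subseteq> {0}"
    by (intro span_minimal) (auto simp: subspace_0)
  hence "(UNIV :: 'h set) \<subseteq> {0}"
    using span_S by simp
  moreover obtain b :: 'h where "b \<in> Basis"
    by (meson nonempty_Basis ex_in_conv)
  ultimately show False
    using nonzero_Basis by auto
qed

lemma zero_in_S: "0 \<in> S"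
  using S_nonempty cone[of _ 0] by auto

lemma bound_A:
  obtains M where "0 < M" "\<And>x. norm (A x) \<le> M * norm x" "\<And>x y. \<bar>x \<bullet> A y\<bar> \<le> M * norm x * norm y"
proof -
  obtain M where M: "0 < M" "\<And>x. norm (A x) \<le> M * norm x"
    using linear_bounded_pos[OF linear_A] by auto
  have "\<bar>x \<bullet> A y\<bar> \<le> M * norm x * norm y" for x y
    using Cauchy_Schwarz_ineq2[of x "A y"] mult_left_mono[OF M(2)[of y], of "norm x"]
    by (simp add: algebra_simps)
  thus ?thesis
    using that M by blast
qed

lemma energy_upper:
  obtains \<beta> where "0 < \<beta>" "\<And>x. energy x \<le> \<beta> * (norm x)\<^sup>2"
proof -
  obtain M where M: "0 < M" "\<And>x. norm (A x) \<le> M * norm x" "\<And>x y. \<bar>x \<bullet> A y\<bar> \<le> M * norm x * norm y"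
    using bound_A by blast
  have "energy x \<le> (M + \<bar>\<nu>\<bar>) * (norm x)\<^sup>2" for x
  proof -
    have "\<nu> * (norm x)\<^sup>2 \<le> \<bar>\<nu>\<bar> * (norm x)\<^sup>2"
      by (intro mult_right_mono) auto
    thus ?thesis
      unfolding energy_def using M(3)[of x x] by (simp add: algebra_simps power2_eq_square)
  qed
  moreover have "0 < M + \<bar>\<nu>\<bar>"
    using M by simp
  ultimately show ?thesis
    using that by blast
qed

lemma sqrt_energy_upper:
  obtains R where "0 < R" "\<And>x. sqrt (energy x) \<le> R * norm x"
proof -
  obtain \<beta> where \<beta>: "0 < \<beta>" "\<And>x. energy x \<le> \<beta> * (norm x)\<^sup>2"
    using energy_upper by blast
  have "sqrt (energy x) \<le> sqrt \<beta> * norm x" for x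
    using real_sqrt_le_mono[OF \<beta>(2)[of x]] by (simp add: real_sqrt_mult)
  thus ?thesis
    using that[of "sqrt \<beta>"] \<beta>(1) by simp
qed

lemma rq_scale: "t \<noteq> 0 \<Longrightarrow> rq (t *\<^sub>R x) = rq x"
  by (simp add: rq_def A_simps power_mult_distrib) (simp add: power2_eq_square)

lemma rq_unit: "norm x = 1 \<Longrightarrow> rq x = x \<bullet> A x"
  by (simp add: rq_def)

lemma rq_sgn:
  assumes "x \<noteq> 0" shows "sgn x \<bullet> A (sgn x) = rq x"
proof -
  have "sgn x \<bullet> A (sgn x) = rq (sgn x)"
    using assms by (simp add: rq_unit norm_sgn)
  also have "\<dots> = rq x"
    unfolding sgn_div_norm using assms by (intro rq_scale) auto
  finally show ?thesis .
qed

text \<open>Quantitative version of the fact that a vector orthogonal to a spanning set vanishes: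
  every basis vector is a finite combination of elements of \<open>S\<close>, so its inner product
  with \<open>x\<close> is controlled. Taking M = 0 recovers the qualitative fact.\<close>

lemma span_bound:
  obtains C where "0 < C"
    "\<And>x M. 0 \<le> M \<Longrightarrow> (\<And>z. z \<in> S \<Longrightarrow> \<bar>x \<bullet> z\<bar> \<le> M * norm z) \<Longrightarrow> norm x \<le> C * M"
proof -
  \<comment> \<open>The constant depends on \<open>b\<close> alone; it must precede \<open>x\<close>
    and \<open>M\<close> for the induction over the span to give a uniform bound.\<close>
  have "\<exists>C. \<forall>x M. 0 \<le> M \<and> (\<forall>z\<in>S. \<bar>x \<bullet> z\<bar> \<le> M * norm z) \<longrightarrow> \<bar>x \<bullet> b\<bar> \<le> C * M" for b
  proof -
    have "b \<in> span S"
      using span_S by simp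
    thus ?thesis
    proof (induction rule: span_induct_alt)
      case base
      show ?case by (intro exI[of _ 0]) simp
    next
      case (step c z b)
      then obtain C where C: "\<And>x M. 0 \<le> M \<Longrightarrow> (\<forall>z\<in>S. \<bar>x \<bullet> z\<bar> \<le> M * norm z) \<Longrightarrow> \<bar>x \<bullet> b\<bar> \<le> C * M"
        by blast
      have "\<bar>x \<bullet> (c *\<^sub>R z + b)\<bar> \<le> (\<bar>c\<bar> * norm z + C) * M"
        if "0 \<le> M" "\<forall>z\<in>S. \<bar>x \<bullet> z\<bar> \<le> M * norm z" for x M
      proof -
        have "\<bar>x \<bullet> (c *\<^sub>R z + b)\<bar> \<le> \<bar>c\<bar> * \<bar>x \<bullet> z\<bar> + \<bar>x \<bullet> b\<bar>"
          by (simp add: inner_add_right flip: abs_mult)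
        also have "\<dots> \<le> \<bar>c\<bar> * (M * norm z) + C * M"
          using that step(1) C by (intro add_mono mult_left_mono) auto
        finally show ?thesis by (simp add: algebra_simps)
      qed
      thus ?case by blast
    qed
  qed
  then obtain c where c: "\<And>b x M. 0 \<le> M \<Longrightarrow> (\<forall>z\<in>S. \<bar>x \<bullet> z\<bar> \<le> M * norm z) \<Longrightarrow> \<bar>x \<bullet> b\<bar> \<le> c b * M"
    by metis
  define C where "C = 1 + (\<Sum>b\<in>Basis. \<bar>c b\<bar>)"
  have "C > 0"
    unfolding C_def by (smt (verit) abs_ge_zero sum_nonneg)
  moreover have "norm x \<le> C * M" if "0 \<le> M" "\<And>z. z \<in> S \<Longrightarrow> \<bar>x \<bullet> z\<bar> \<le> M * norm z" for x M
  proof -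
    have "norm x \<le> (\<Sum>b\<in>Basis. \<bar>x \<bullet> b\<bar>)"
      by (rule norm_le_l1)
    also have "\<dots> \<le> (\<Sum>b\<in>Basis. \<bar>c b\<bar> * M)"
    proof (rule sum_mono)
      fix b
      have "\<bar>x \<bullet> b\<bar> \<le> c b * M"
        using c that by blast
      also have "\<dots> \<le> \<bar>c b\<bar> * M"
        using that by (intro mult_right_mono) auto
      finally show "\<bar>x \<bullet> b\<bar> \<le> \<bar>c b\<bar> * M" .
    qed
    also have "\<dots> \<le> C * M"
      using that unfolding C_def by (simp add: algebra_simps flip: sum_distrib_left)
    finally show ?thesis .
  qed
  ultimately show ?thesis
    using that by blast
qed

text \<open>The shifted form \<open>b\<close> vanishes at the minimiser and is nonnegative on
  \<open>u + S\<close>. Stationarity along \<open>z\<close> identifies the drop with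
  \<open>b z z\<close>, which the gap d - l bounds below by a multiple of the squared norm of
  \<open>z\<close>; the discriminant at \<open>u\<close> bounds the residual. The constant depends
  on the gap, not on \<open>u\<close>.\<close>

lemma Rayleigh_greedy_descent:
  assumes "l < d" and d: "\<And>y. y \<in> S \<Longrightarrow> y \<noteq> 0 \<Longrightarrow> d \<le> rq y"
  shows "\<exists>C\<ge>0. \<forall>u z. norm u = 1 \<longrightarrow> u \<bullet> A u \<le> l \<longrightarrow> z \<in> S \<longrightarrow> u + z \<noteq> 0 \<longrightarrow>
      (\<forall>y\<in>S. u + y \<noteq> 0 \<longrightarrow> rq (u + z) \<le> rq (u + y)) \<longrightarrow>
      descent_step C u (sgn (u + z))"
proof -
  obtain M where M: "0 < M" "\<And>x. norm (A x) \<le> M * norm x" "\<And>x y. \<bar>x \<bullet> A y\<bar> \<le> M * norm x * norm y"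
    using bound_A by blast
  \<comment> \<open>The first summand serves the residual, the second the step.\<close>
  define C where "C = 2 * sqrt (2 * M) + 2 / sqrt (d - l)"
  have "0 \<le> C"
    unfolding C_def using M \<open>l < d\<close> by simp
  moreover have "descent_step C u (sgn (u + z))"
    if u: "norm u = 1" "u \<bullet> A u \<le> l" and z: "z \<in> S" "u + z \<noteq> 0"
      and min: "\<forall>y\<in>S. u + y \<noteq> 0 \<longrightarrow> rq (u + z) \<le> rq (u + y)" for u z
  proof -
    define x where "x = u + z"
    define m where "m = rq x"
    define b where "b p q = p \<bullet> A q - m * (p \<bullet> q)" for p q
    have b_expand: "b (p + t *\<^sub>R q) (p + t *\<^sub>R q) = b p p + 2 * t * b p q + t\<^sup>2 * b q q" for p q t
      using selfadjoint[of q p]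
      by (simp add: b_def A_simps inner_add_left inner_add_right inner_commute algebra_simps power2_eq_square)
    \<comment> \<open>Minimality of \<open>m\<close>, with denominators cleared; at the origin,
      where minimality says nothing, \<open>b\<close> is 0.\<close>
    have \<delta>0: "0 \<le> b (u + y) (u + y)" if "y \<in> S" for y
    proof (cases "u + y = 0")
      case False
      hence "m \<le> (u + y) \<bullet> A (u + y) / (norm (u + y))\<^sup>2"
        using min that False unfolding m_def x_def rq_def by simp
      thus ?thesis
        using False by (simp add: b_def field_simps power2_norm_eq_inner)
    qed (simp add: b_def A_simps)
    have bx: "b x x = 0"
      using z(2) unfolding b_def m_def rq_def x_def by (simp add: power2_norm_eq_inner)
    have mb: "\<bar>m\<bar> \<le> M"
      using M(3)[of x x] z(2) unfolding m_def rq_def x_def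
      by (simp add: abs_mult field_simps power2_eq_square)
    have b_le: "b y y \<le> 2 * M * (norm y)\<^sup>2" for y
    proof -
      have "- m * (norm y)\<^sup>2 \<le> M * (norm y)\<^sup>2"
        using mb by (intro mult_right_mono) auto
      thus ?thesis
        using M(3)[of y y] unfolding b_def
        by (simp add: power2_norm_eq_inner) (simp add: power2_eq_square flip: power2_norm_eq_inner)
    qed
    \<comment> \<open>Euler equation along the ray of \<open>z\<close>: x + t z = u + (1 + t) z
      stays admissible for every real t. The summand 1 keeps the bound positive when
      \<open>z = 0\<close>.\<close>
    have "(b x z)\<^sup>2 \<le> 0 * (2 * M * (norm z)\<^sup>2 + 1)"
    proof (rule quadratic_nonneg_imp)
      show "b z z \<le> 2 * M * (norm z)\<^sup>2 + 1"
        using b_le[of z] by simp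
      show "0 < 2 * M * (norm z)\<^sup>2 + 1"
        using M by (intro add_nonneg_pos) auto
      show "0 \<le> 0 + 2 * t * b x z + t\<^sup>2 * b z z" for t
        using \<delta>0[OF cone[OF z(1), of "1 + t"]] b_expand[of x t z] bx
        by (simp add: x_def algebra_simps)
    qed
    hence bxz: "b x z = 0"
      by simp
    define \<delta> where "\<delta> = u \<bullet> A u - m"
    have \<delta>u: "\<delta> = b u u"
      using u(1) by (simp add: \<delta>_def b_def flip: power2_norm_eq_inner)
    have \<delta>z: "\<delta> = b z z"
      using b_expand[of x "-1" z] bx bxz unfolding \<delta>u x_def by simp
    have "0 \<le> \<delta>"
      using \<delta>0[OF zero_in_S] \<delta>u by simp
    \<comment> \<open>Here the gap enters: the new value \<open>m\<close> is at most
      \<open>l\<close>, while the quotient at \<open>z\<close> is at least \<open>d\<close>.\<close>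
    have "(d - l) * (norm z)\<^sup>2 \<le> \<delta>"
    proof (cases "z = 0")
      case False
      have "d * (norm z)\<^sup>2 \<le> z \<bullet> A z"
        using d[OF z(1) False] False unfolding rq_def by (simp add: field_simps)
      moreover have "m * (norm z)\<^sup>2 \<le> l * (norm z)\<^sup>2"
        using \<open>0 \<le> \<delta>\<close> u(2) unfolding \<delta>_def by (intro mult_right_mono) auto
      ultimately show ?thesis
        unfolding \<delta>z b_def by (simp add: algebra_simps flip: power2_norm_eq_inner)
    qed (use \<open>0 \<le> \<delta>\<close> in auto)
    hence "sqrt ((d - l) * (norm z)\<^sup>2) \<le> sqrt \<delta>"
      by (rule real_sqrt_le_mono)
    hence z_le: "norm z \<le> sqrt \<delta> / sqrt (d - l)"
      using \<open>l < d\<close> by (simp add: real_sqrt_mult pos_le_divide_eq mult.commute)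
    have sg: "sgn (u + z) \<bullet> A (sgn (u + z)) = m"
      unfolding m_def x_def using z(2) by (rule rq_sgn)
    have bu: "\<bar>b u y\<bar> \<le> sqrt (2 * M) * sqrt \<delta> * norm y" if "y \<in> S" for y
    proof (cases "y = 0")
      case True
      thus ?thesis by (simp add: b_def A_simps)
    next
      case False
      have "(b u y)\<^sup>2 \<le> \<delta> * (2 * M * (norm y)\<^sup>2)"
      proof (rule quadratic_nonneg_imp)
        show "0 \<le> \<delta> + 2 * t * b u y + t\<^sup>2 * b y y" for t
          using \<delta>0[OF cone[OF that, of t]] b_expand[of u t y] \<delta>u by simp
      qed (use b_le False M in auto)
      hence "sqrt ((b u y)\<^sup>2) \<le> sqrt (\<delta> * (2 * M * (norm y)\<^sup>2))"
        by (rule real_sqrt_le_mono)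
      thus ?thesis
        by (simp add: real_sqrt_mult algebra_simps)
    qed
    \<comment> \<open>The residual is formed with the old value m + \<delta>, whereas
      \<open>b\<close> uses \<open>m\<close>; the discrepancy is linear in \<delta> and is absorbed
      because \<delta> is bounded.\<close>
    have \<delta>_le: "\<delta> \<le> sqrt (2 * M) * sqrt \<delta>"
    proof -
      have "\<delta> \<le> 2 * M"
        using b_le[of u] u(1) \<delta>u by simp
      hence "sqrt \<delta> * sqrt \<delta> \<le> sqrt (2 * M) * sqrt \<delta>"
        using \<open>0 \<le> \<delta>\<close> by (intro mult_right_mono) auto
      thus ?thesis using \<open>0 \<le> \<delta>\<close> by simp
    qed
    have "\<bar>(A u - (u \<bullet> A u) *\<^sub>R u) \<bullet> y\<bar> \<le> C * sqrt \<delta> * norm y" if "y \<in> S" for y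
    proof -
      have "(A u - (u \<bullet> A u) *\<^sub>R u) \<bullet> y = b u y - \<delta> * (u \<bullet> y)"
        unfolding b_def \<delta>_def by (simp add: selfadjoint algebra_simps)
      hence "\<bar>(A u - (u \<bullet> A u) *\<^sub>R u) \<bullet> y\<bar> \<le> \<bar>b u y\<bar> + \<delta> * \<bar>u \<bullet> y\<bar>"
        using abs_triangle_ineq4[of "b u y" "\<delta> * (u \<bullet> y)"] \<open>0 \<le> \<delta>\<close> by (simp add: abs_mult)
      also have "\<dots> \<le> sqrt (2 * M) * sqrt \<delta> * norm y + (sqrt (2 * M) * sqrt \<delta>) * norm y"
        using bu[OF that] \<delta>_le \<open>0 \<le> \<delta>\<close> Cauchy_Schwarz_ineq2[of u y] u(1) M
        by (intro add_mono mult_mono) auto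
      also have "\<dots> = 2 * sqrt (2 * M) * (sqrt \<delta> * norm y)"
        by simp
      also have "\<dots> \<le> C * (sqrt \<delta> * norm y)"
        unfolding C_def using \<open>l < d\<close> \<open>0 \<le> \<delta>\<close> by (intro mult_right_mono) auto
      finally show ?thesis by simp
    qed
    moreover have "norm (sgn (u + z) - u) \<le> C * sqrt \<delta>"
    proof -
      have "norm (sgn (u + z) - u) \<le> 2 * (sqrt \<delta> / sqrt (d - l))"
        using norm_sgn_add_diff_le[OF u(1) z(2)] z_le by linarith
      also have "\<dots> = 2 / sqrt (d - l) * sqrt \<delta>"
        by simp
      also have "\<dots> \<le> C * sqrt \<delta>"
        unfolding C_def using M \<open>0 \<le> \<delta>\<close> by (intro mult_right_mono) auto
      finally show ?thesis .
    qed
    ultimately show ?thesis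
      unfolding descent_step_def sg using \<open>0 \<le> \<delta>\<close> unfolding \<delta>_def by auto
  qed
  ultimately show ?thesis
    by blast
qed

text \<open>Up to a constant the functional is \<open>r \<bullet> y + 1/2 * energy y\<close> with
  \<open>r\<close> the residual. The Euler equation along \<open>z\<close> gives minimal value
  \<open>- energy z / 2\<close>; comparison with the other rays bounds \<open>r\<close> on
  \<open>S\<close> by the root of \<open>energy z\<close>, which in turn is bounded by the
  drop.\<close>

lemma residual_greedy_descent:
  obtains C where "0 \<le> C"
    "\<And>u z. norm u = 1 \<Longrightarrow> z \<in> S \<Longrightarrow>
      (\<And>y. y \<in> S \<Longrightarrow> 1/2 * energy (u + z) - (u \<bullet> A u + \<nu>) * (u \<bullet> z)
              \<le> 1/2 * energy (u + y) - (u \<bullet> A u + \<nu>) * (u \<bullet> y)) \<Longrightarrow>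
      u + z \<noteq> 0 \<and> descent_step C u (sgn (u + z))"
proof -
  obtain M where M: "0 < M" "\<And>x. norm (A x) \<le> M * norm x" "\<And>x y. \<bar>x \<bullet> A y\<bar> \<le> M * norm x * norm y"
    using bound_A by blast
  obtain \<beta> where "0 < \<beta>" and energy_le: "\<And>y. energy y \<le> \<beta> * (norm y)\<^sup>2"
    using energy_upper by blast
  have energy_ge: "(norm y)\<^sup>2 \<le> energy y" for y
    unfolding energy_def by (rule coercive)
  have energy_scale: "energy (t *\<^sub>R y) = t\<^sup>2 * energy y" for t y
    by (simp add: energy_def A_simps power_mult_distrib algebra_simps power2_eq_square)
  \<comment> \<open>\<open>1 + 2 * M\<close> bounds \<open>norm (u + z)\<close>; 2 comes from the
    normalisation and \<open>sqrt \<beta>\<close> from the residual.\<close>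
  define C where "C = (2 + sqrt \<beta>) * (1 + 2 * M)"
  have "0 \<le> C"
    unfolding C_def using M \<open>0 < \<beta>\<close> by simp
  moreover have "u + z \<noteq> 0 \<and> descent_step C u (sgn (u + z))"
    if u: "norm u = 1" and z: "z \<in> S"
      and min: "\<And>y. y \<in> S \<Longrightarrow> 1/2 * energy (u + z) - (u \<bullet> A u + \<nu>) * (u \<bullet> z)
              \<le> 1/2 * energy (u + y) - (u \<bullet> A u + \<nu>) * (u \<bullet> y)" for u z
  proof -
    define l where "l = u \<bullet> A u"
    define r where "r = A u - l *\<^sub>R u"
    have uu: "u \<bullet> u = 1"
      using u by (simp flip: power2_norm_eq_inner)
    have expand: "1/2 * energy (u + y) - (l + \<nu>) * (u \<bullet> y) = 1/2 * energy u + (r \<bullet> y + 1/2 * energy y)" for y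
      using selfadjoint[of u y]
      by (simp add: energy_def r_def A_simps inner_add_left inner_add_right inner_diff_left
          power2_norm_eq_inner inner_commute algebra_simps)
    have min': "r \<bullet> z + 1/2 * energy z \<le> r \<bullet> y + 1/2 * energy y" if "y \<in> S" for y
      using min[OF that] unfolding expand[unfolded l_def] by simp
    \<comment> \<open>Minimality along (1 + t) z, where t = 0 is optimal, forces the linear
      coefficient to vanish.\<close>
    have "((r \<bullet> z + energy z) / 2)\<^sup>2 \<le> 0 * (energy z / 2 + 1)"
    proof (rule quadratic_nonneg_imp)
      show "0 < energy z / 2 + 1"
        using energy_ge[of z] by (smt (verit) zero_le_power2 divide_nonneg_pos)
      show "0 \<le> 0 + 2 * t * ((r \<bullet> z + energy z) / 2) + t\<^sup>2 * (energy z / 2)" for t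
        using min'[OF cone[OF z, of "1 + t"]] unfolding energy_scale inner_scaleR_right
        by (simp add: field_simps power2_eq_square)
    qed simp
    hence rz: "r \<bullet> z = - energy z"
      by simp
    have ry: "\<bar>r \<bullet> y\<bar> \<le> sqrt \<beta> * sqrt (energy z) * norm y" if "y \<in> S" for y
    proof (cases "y = 0")
      case False
      have "((r \<bullet> y) / 2)\<^sup>2 \<le> (energy z / 2) * (\<beta> * (norm y)\<^sup>2 / 2)"
      proof (rule quadratic_nonneg_imp)
        show "0 \<le> energy z / 2 + 2 * t * ((r \<bullet> y) / 2) + t\<^sup>2 * (energy y / 2)" for t
          using min'[OF cone[OF that, of t]] rz by (simp add: energy_scale)
      qed (use energy_le[of y] False \<open>0 < \<beta>\<close> in auto)
      hence "(r \<bullet> y)\<^sup>2 \<le> \<beta> * energy z * (norm y)\<^sup>2"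
        by (simp add: power2_eq_square algebra_simps)
      hence "sqrt ((r \<bullet> y)\<^sup>2) \<le> sqrt (\<beta> * energy z * (norm y)\<^sup>2)"
        by (rule real_sqrt_le_mono)
      thus ?thesis
        by (simp add: real_sqrt_mult)
    qed simp
    have l: "1 \<le> l + \<nu>" "\<bar>l\<bar> \<le> M"
      using energy_ge[of u] M(3)[of u u] u unfolding energy_def l_def by auto
    have "norm r \<le> 2 * M"
      using norm_triangle_ineq4[of "A u" "l *\<^sub>R u"] M(2)[of u] l(2) u unfolding r_def by simp
    have z_le: "norm z \<le> 2 * M"
    proof (cases "z = 0")
      case False
      have "(norm z)\<^sup>2 \<le> \<bar>r \<bullet> z\<bar>"
        using energy_ge[of z] rz by simp
      also have "\<dots> \<le> norm r * norm z"
        by (rule Cauchy_Schwarz_ineq2)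
      also have "\<dots> \<le> 2 * M * norm z"
        using \<open>norm r \<le> 2 * M\<close> by (intro mult_right_mono) auto
      finally show ?thesis
        using False by (simp add: power2_eq_square)
    qed (use M in auto)
    have nz: "u + z \<noteq> 0"
    proof
      assume "u + z = 0"
      hence "z = - u"
        by (simp add: eq_neg_iff_add_eq_0 add.commute)
      \<comment> \<open>The residual is orthogonal to \<open>u\<close>, as \<open>l\<close> is the
        Rayleigh quotient of the unit vector \<open>u\<close>.\<close>
      hence "r \<bullet> z = 0"
        using uu by (simp add: r_def l_def inner_diff_left selfadjoint)
      hence "(norm z)\<^sup>2 \<le> 0"
        using rz energy_ge[of z] by simp
      thus False
        using \<open>z = - u\<close> u by simp
    qed
    define x where "x = u + z"
    define \<delta> where "\<delta> = l - rq x"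
    have "(norm x)\<^sup>2 > 0"
      using nz unfolding x_def by simp
    have "\<delta> * (norm x)\<^sup>2 = l * (norm x)\<^sup>2 - x \<bullet> A x"
      using \<open>(norm x)\<^sup>2 > 0\<close> unfolding \<delta>_def rq_def by (simp add: algebra_simps)
    \<comment> \<open>The Euler equation turns the drop, scaled by the squared norm of
      \<open>x\<close>, into two nonnegative terms, since \<open>l + \<nu>\<close> is at least
      1.\<close>
    also have "\<dots> = energy z + (l + \<nu>) * (norm z)\<^sup>2"
    proof -
      have "A u \<bullet> z = l * (u \<bullet> z) - z \<bullet> A z - \<nu> * (norm z)\<^sup>2"
        using rz unfolding r_def energy_def by (simp add: inner_diff_left)
      thus ?thesis
        using uu selfadjoint[of u z]
        by (simp add: x_def energy_def A_simps l_def inner_add_left inner_add_right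
          power2_norm_eq_inner inner_commute algebra_simps)
    qed
    finally have \<delta>_eq: "\<delta> * (norm x)\<^sup>2 = energy z + (l + \<nu>) * (norm z)\<^sup>2" .
    hence "energy z \<le> \<delta> * (norm x)\<^sup>2"
      using l by simp
    moreover have "0 \<le> energy z"
      using energy_ge[of z] by (smt (verit) zero_le_power2)
    ultimately have "0 \<le> \<delta>"
      using \<open>(norm x)\<^sup>2 > 0\<close> by (smt (verit) mult_neg_pos)
    have "norm x \<le> 1 + 2 * M"
      using norm_triangle_ineq[of u z] u z_le unfolding x_def by simp
    hence "\<delta> * (norm x)\<^sup>2 \<le> \<delta> * (1 + 2 * M)\<^sup>2"
      using \<open>0 \<le> \<delta>\<close> by (intro mult_left_mono power_mono) auto
    hence "sqrt (energy z) \<le> sqrt (\<delta> * (1 + 2 * M)\<^sup>2)"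
      using \<open>energy z \<le> \<delta> * (norm x)\<^sup>2\<close> by simp
    hence E_le: "sqrt (energy z) \<le> (1 + 2 * M) * sqrt \<delta>"
      using M by (simp add: real_sqrt_mult mult.commute)
    have sg: "sgn (u + z) \<bullet> A (sgn (u + z)) = rq x"
      unfolding x_def using nz by (rule rq_sgn)
    have "\<bar>r \<bullet> y\<bar> \<le> C * sqrt \<delta> * norm y" if "y \<in> S" for y
    proof -
      have "\<bar>r \<bullet> y\<bar> \<le> sqrt \<beta> * sqrt (energy z) * norm y"
        using ry that .
      also have "\<dots> \<le> sqrt \<beta> * ((1 + 2 * M) * sqrt \<delta>) * norm y"
        using E_le \<open>0 < \<beta>\<close> by (intro mult_right_mono mult_left_mono) auto
      also have "\<dots> = (sqrt \<beta> * (1 + 2 * M)) * (sqrt \<delta> * norm y)"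
        by simp
      also have "\<dots> \<le> C * (sqrt \<delta> * norm y)"
        unfolding C_def using M \<open>0 \<le> \<delta>\<close> by (intro mult_right_mono) auto
      finally show ?thesis by simp
    qed
    moreover have "norm (sgn (u + z) - u) \<le> C * sqrt \<delta>"
    proof -
      have "norm z \<le> sqrt (energy z)"
        using real_sqrt_le_mono[OF energy_ge[of z]] by simp
      hence "norm (sgn (u + z) - u) \<le> 2 * ((1 + 2 * M) * sqrt \<delta>)"
        using norm_sgn_add_diff_le[OF u nz] E_le by linarith
      also have "\<dots> = 2 * (1 + 2 * M) * sqrt \<delta>"
        by simp
      also have "\<dots> \<le> C * sqrt \<delta>"
        unfolding C_def using M \<open>0 < \<beta>\<close> \<open>0 \<le> \<delta>\<close> by (intro mult_right_mono) auto
      finally show ?thesis .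
    qed
    ultimately show ?thesis
      unfolding descent_step_def sg using nz \<open>0 \<le> \<delta>\<close> unfolding \<delta>_def r_def l_def by auto
  qed
  ultimately show ?thesis
    using that by blast
qed

section \<open>The Lojasiewicz inequality near an eigenspace\<close>

definition unit_eigenvectors :: "real \<Rightarrow> 'h set" where
  "unit_eigenvectors \<mu> = {x. A x = \<mu> *\<^sub>R x \<and> norm x = 1}"

text \<open>Derivative of \<open>rq\<close> at nonzero \<open>x\<close> in direction
  \<open>z\<close>, written through the residual so that the Lojasiewicz inequality becomes a bound
  by the residual.\<close>

definition rq_deriv :: "'h \<Rightarrow> 'h \<Rightarrow> real" where
  "rq_deriv x z = 2 / (norm x)\<^sup>2 * ((A x - rq x *\<^sub>R x) \<bullet> z)"

text \<open>The injective norm read on \<open>H\<close>. For linear functionals the absolute value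
  may be omitted because \<open>S\<close> is symmetric.\<close>

definition dual_norm :: "('h \<Rightarrow> real) \<Rightarrow> real" where
  "dual_norm l = (SUP z\<in>S - {0}. l z / sqrt (energy z))"

lemma tendsto_A [tendsto_intros]: "(f \<longlongrightarrow> x) F \<Longrightarrow> ((\<lambda>n. A (f n)) \<longlongrightarrow> A x) F"
  using linear_A by (simp add: linear_conv_bounded_linear bounded_linear.tendsto)

lemma norm_le_sqrt_energy: "norm x \<le> sqrt (energy x)"
  using real_sqrt_le_mono[OF coercive[of x]] by (simp add: energy_def)

lemma dual_norm_le:
  assumes "0 \<le> B" "\<And>z. z \<in> S \<Longrightarrow> l z \<le> B * norm z"
  shows "dual_norm l \<le> B"
  unfolding dual_norm_def
proof (rule cSUP_least)
  show "S - {0} \<noteq> {}"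
    using S_nonempty by auto
  fix z assume z: "z \<in> S - {0}"
  hence "0 < sqrt (energy z)"
    using norm_le_sqrt_energy[of z] by (smt (verit) DiffE insertI1 zero_less_norm_iff)
  moreover have "l z \<le> B * sqrt (energy z)"
    using assms(2)[of z] mult_left_mono[OF norm_le_sqrt_energy assms(1), of z] z by auto
  ultimately show "l z / sqrt (energy z) \<le> B"
    by (simp add: pos_divide_le_eq)
qed

text \<open>Testing on a spanning cone determines a norm in finite dimension;
  \<open>span_bound\<close> applies once the energy norm is compared with the Euclidean one.\<close>

lemma norm_le_dual_norm:
  obtains C where "0 < C" "\<And>x. norm x \<le> C * dual_norm (\<lambda>z. x \<bullet> z)"
proof -
  obtain C where C: "0 < C"
    "\<And>x M. 0 \<le> M \<Longrightarrow> (\<And>z. z \<in> S \<Longrightarrow> \<bar>x \<bullet> z\<bar> \<le> M * norm z) \<Longrightarrow> norm x \<le> C * M"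
    using span_bound by blast
  obtain R where "0 < R" and sqrt_le: "\<And>z. sqrt (energy z) \<le> R * norm z"
    using sqrt_energy_upper by blast
  have "norm x \<le> C * R * dual_norm (\<lambda>z. x \<bullet> z)" for x
  proof -
    \<comment> \<open>The real-valued supremum bounds its members only when the set is bounded
      above.\<close>
    have bdd: "bdd_above ((\<lambda>z. x \<bullet> z / sqrt (energy z)) ` (S - {0}))"
    proof (intro bdd_aboveI2)
      fix z assume z: "z \<in> S - {0}"
      hence "0 < sqrt (energy z)"
        using norm_le_sqrt_energy[of z] by (smt (verit) DiffE insertI1 zero_less_norm_iff)
      moreover have "x \<bullet> z \<le> norm x * sqrt (energy z)"
        using norm_cauchy_schwarz[of x z] mult_left_mono[OF norm_le_sqrt_energy[of z], of "norm x"] by simp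
      ultimately show "x \<bullet> z / sqrt (energy z) \<le> norm x"
        by (simp add: pos_divide_le_eq)
    qed
    define D where "D = dual_norm (\<lambda>z. x \<bullet> z)"
    have upper: "x \<bullet> z \<le> D * sqrt (energy z)" if "z \<in> S" "z \<noteq> 0" for z
    proof -
      have "x \<bullet> z / sqrt (energy z) \<le> D"
        unfolding D_def dual_norm_def using that by (intro cSUP_upper bdd) auto
      moreover have "0 < sqrt (energy z)"
        using norm_le_sqrt_energy[of z] that by (smt (verit) zero_less_norm_iff)
      ultimately show ?thesis
        by (simp add: pos_divide_le_eq)
    qed
    have upper': "\<bar>x \<bullet> z\<bar> \<le> D * sqrt (energy z)" if "z \<in> S" "z \<noteq> 0" for z
      using upper[OF that] upper[of "- z"] that cone[OF that(1), of "-1"]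
      by (simp add: energy_def A_simps linear_neg[OF linear_A])
    have "0 \<le> D"
    proof -
      obtain z where z: "z \<in> S" "z \<noteq> 0"
        using S_nonempty by auto
      have "0 \<le> D * sqrt (energy z)" "0 < sqrt (energy z)"
        using upper'[OF z] norm_le_sqrt_energy[of z] z by (smt (verit) zero_less_norm_iff)+
      thus ?thesis
        by (simp add: zero_le_mult_iff)
    qed
    have "norm x \<le> C * (D * R)"
    proof (rule C(2))
      show "0 \<le> D * R"
        using \<open>0 \<le> D\<close> \<open>0 < R\<close> by simp
      fix z assume "z \<in> S"
      show "\<bar>x \<bullet> z\<bar> \<le> D * R * norm z"
      proof (cases "z = 0")
        case False
        thus ?thesis
          using upper'[OF \<open>z \<in> S\<close>] mult_left_mono[OF sqrt_le[of z] \<open>0 \<le> D\<close>] by simp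
      qed simp
    qed
    thus ?thesis
      by (simp add: D_def algebra_simps)
  qed
  moreover have "0 < C * R"
    using C \<open>0 < R\<close> by simp
  ultimately show ?thesis
    using that by blast
qed

text \<open>
  Near the eigenspace, a vector with component \<open>q\<close> orthogonal to it has a Rayleigh quotient at
  distance \<open>O(|q|\<^sup>2)\<close> from the eigenvalue and a residual of size at least a multiple of \<open>|q|\<close>.
\<close>

lemma Lojasiewicz_half:
  assumes "unit_eigenvectors \<mu> \<noteq> {}"
  obtains K \<epsilon> where "0 \<le> K" "0 < \<epsilon>"
    "\<And>x. 1/2 < norm x \<Longrightarrow> norm x < 3/2 \<Longrightarrow> infdist x (unit_eigenvectors \<mu>) \<le> \<epsilon> \<Longrightarrow>
      \<bar>rq x - \<mu>\<bar> powr (1 / 2) \<le> K * dual_norm (rq_deriv x)"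
proof -
  define G where "G x = A x - \<mu> *\<^sub>R x" for x
  have lin_G: "linear G"
    unfolding G_def by (intro linear_compose_sub linear_A linear_scale_self)
  have sa_G: "G x \<bullet> y = x \<bullet> G y" for x y
    by (simp add: G_def selfadjoint inner_diff_left inner_diff_right)
  define E where "E = {x. G x = 0}"
  have "subspace E"
    unfolding E_def using lin_G by (auto simp: subspace_def linear_0 linear_add linear_cmul)
  define P where "P = {q. \<forall>p\<in>E. orthogonal q p}"
  have "subspace P"
    unfolding P_def by (auto simp: subspace_def orthogonal_def inner_add_left)
  \<comment> \<open>On the complement of its kernel the selfadjoint map \<open>G\<close> is
    injective, hence bounded below.\<close>
  have "\<exists>e>0. \<forall>q\<in>P. norm (G q) \<ge> e * norm q"
  proof (rule injective_imp_isometric)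
    show "\<forall>q\<in>P. G q = 0 \<longrightarrow> q = 0"
      unfolding P_def E_def by (auto simp: orthogonal_def)
  qed (use \<open>subspace P\<close> lin_G in \<open>auto simp: closed_subspace linear_conv_bounded_linear\<close>)
  then obtain d where d: "0 < d" "\<And>q. q \<in> P \<Longrightarrow> d * norm q \<le> norm (G q)"
    by auto
  obtain M where M: "0 < M" "\<And>x. norm (G x) \<le> M * norm x"
    using linear_bounded_pos[OF lin_G] by auto
  obtain C where C: "0 < C" "\<And>x. norm x \<le> C * dual_norm (\<lambda>z. x \<bullet> z)"
    using norm_le_dual_norm by blast
  \<comment> \<open>Makes 6M * 2\<epsilon> = d/2, so that replacing \<mu> by \<open>rq x\<close>
    perturbs \<open>G q\<close> by at most half of its lower bound.\<close>
  define \<epsilon> where "\<epsilon> = d / (24 * M)"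
  define K where "K = sqrt (4 * M) * (9/4 * C / d)"
  have "0 \<le> K" "0 < \<epsilon>"
    unfolding K_def \<epsilon>_def using C M d by auto
  moreover have "\<bar>rq x - \<mu>\<bar> powr (1 / 2) \<le> K * dual_norm (rq_deriv x)"
    if x: "1/2 < norm x" "norm x < 3/2" and dist: "infdist x (unit_eigenvectors \<mu>) \<le> \<epsilon>" for x
  proof -
    \<comment> \<open>A strict bound yields an actual eigenvector near \<open>x\<close>, so that no
      minimiser of the distance is required.\<close>
    have "infdist x (unit_eigenvectors \<mu>) < 2 * \<epsilon>"
      using dist \<open>0 < \<epsilon>\<close> by linarith
    then obtain w where w: "w \<in> unit_eigenvectors \<mu>" "dist x w < 2 * \<epsilon>"
      using assms by (auto simp: infdist_def cINF_less_iff)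
    obtain p q where pq: "p \<in> span E" "\<And>v. v \<in> span E \<Longrightarrow> orthogonal q v" "x = p + q"
      using orthogonal_subspace_decomp_exists by blast
    hence "p \<in> E" "q \<in> P" "G p = 0"
      using \<open>subspace E\<close> by (auto simp: span_eq_iff[THEN iffD2] P_def E_def)
    have "w \<in> E"
      using w(1) by (simp add: E_def G_def unit_eigenvectors_def)
    have "norm q \<le> norm (x - w)"
    proof -
      have "orthogonal (p - w) q"
        using \<open>q \<in> P\<close> \<open>p \<in> E\<close> \<open>w \<in> E\<close> \<open>subspace E\<close>
        by (auto simp: P_def orthogonal_commute intro: subspace_diff)
      hence "(norm (x - w))\<^sup>2 = (norm (p - w))\<^sup>2 + (norm q)\<^sup>2"
        using norm_add_Pythagorean[of "p - w" q] pq(3) by (simp add: algebra_simps)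
      hence "(norm q)\<^sup>2 \<le> (norm (x - w))\<^sup>2"
        by simp
      thus ?thesis
        by (rule power2_le_imp_le) simp
    qed
    hence q_le: "norm q \<le> 2 * \<epsilon>"
      using w(2) by (simp add: dist_norm)
    have "G x = G q"
      using \<open>G p = 0\<close> pq(3) lin_G by (simp add: linear_add)
    have "x \<noteq> 0"
      using x by auto
    have nx: "1 / 4 < (norm x)\<^sup>2" "(norm x)\<^sup>2 < 9 / 4"
      using power_strict_mono[OF x(1), of 2] power_strict_mono[OF x(2), of 2] by (auto simp: power_divide)
    have "rq x - \<mu> = x \<bullet> G x / (norm x)\<^sup>2"
      using \<open>x \<noteq> 0\<close> by (simp add: rq_def G_def inner_diff_right diff_divide_distrib flip: power2_norm_eq_inner)
    \<comment> \<open>Both occurrences of the kernel component drop out by selfadjointness, which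
      makes the defect quadratic in \<open>q\<close>.\<close>
    also have "x \<bullet> G x = q \<bullet> G q"
      unfolding \<open>G x = G q\<close> using \<open>G p = 0\<close> pq(3) sa_G[of p q] by (simp add: inner_add_left)
    finally have "\<bar>rq x - \<mu>\<bar> = \<bar>q \<bullet> G q\<bar> / (norm x)\<^sup>2"
      by (simp add: abs_divide)
    also have "\<dots> \<le> (M * (norm q)\<^sup>2) / (1 / 4)"
    proof (rule frac_le)
      show "\<bar>q \<bullet> G q\<bar> \<le> M * (norm q)\<^sup>2"
        using Cauchy_Schwarz_ineq2[of q "G q"] mult_left_mono[OF M(2)[of q], of "norm q"]
        by (simp add: power2_eq_square algebra_simps)
    qed (use nx M in auto)
    finally have rq_le: "\<bar>rq x - \<mu>\<bar> \<le> 4 * M * (norm q)\<^sup>2"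
      by simp
    have "\<bar>rq x - \<mu>\<bar> * norm x \<le> 4 * M * (norm q)\<^sup>2 * (3 / 2)"
      using rq_le x M by (intro mult_mono) auto
    also have "\<dots> = 6 * M * norm q * norm q"
      by (simp add: power2_eq_square)
    also have "\<dots> \<le> 6 * M * (2 * \<epsilon>) * norm q"
      using q_le M by (intro mult_right_mono mult_left_mono) auto
    also have "\<dots> = d / 2 * norm q"
      using M unfolding \<epsilon>_def by simp
    finally have small: "norm ((rq x - \<mu>) *\<^sub>R x) \<le> d / 2 * norm q"
      by simp
    define r where "r = A x - rq x *\<^sub>R x"
    have "r = G q - (rq x - \<mu>) *\<^sub>R x"
      unfolding r_def \<open>G x = G q\<close>[symmetric] by (simp add: G_def algebra_simps)
    hence "norm r = norm (G q - (rq x - \<mu>) *\<^sub>R x)"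
      by simp
    hence "d / 2 * norm q \<le> norm r"
      using norm_triangle_ineq2[of "G q" "(rq x - \<mu>) *\<^sub>R x"] small d(2)[OF \<open>q \<in> P\<close>] by linarith
    define c where "c = 2 / (norm x)\<^sup>2"
    have "2 / (9/4) \<le> c"
      unfolding c_def using nx by (intro divide_left_mono) auto
    have "2 / (9/4) * norm r \<le> c * norm r"
      using \<open>2 / (9/4) \<le> c\<close> by (intro mult_right_mono) auto
    also have "\<dots> = norm (c *\<^sub>R r)"
      using \<open>2 / (9/4) \<le> c\<close> by simp
    also have "\<dots> \<le> C * dual_norm (rq_deriv x)"
      using C(2)[of "c *\<^sub>R r"] by (simp add: rq_deriv_def[abs_def] c_def r_def)
    finally have "norm r \<le> 9/8 * (C * dual_norm (rq_deriv x))"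
      by simp
    hence "d / 2 * norm q \<le> 9/8 * (C * dual_norm (rq_deriv x))"
      using \<open>d / 2 * norm q \<le> norm r\<close> by linarith
    hence q_dual: "norm q \<le> 9/4 * C / d * dual_norm (rq_deriv x)"
      using d(1) by (simp add: field_simps)
    have "\<bar>rq x - \<mu>\<bar> powr (1 / 2) = sqrt \<bar>rq x - \<mu>\<bar>"
      by (simp add: powr_half_sqrt)
    also have "\<dots> \<le> sqrt (4 * M * (norm q)\<^sup>2)"
      using rq_le by (rule real_sqrt_le_mono)
    also have "\<dots> = sqrt (4 * M) * norm q"
      by (simp add: real_sqrt_mult)
    also have "\<dots> \<le> sqrt (4 * M) * (9/4 * C / d * dual_norm (rq_deriv x))"
      using q_dual M by (intro mult_left_mono) auto
    also have "\<dots> = K * dual_norm (rq_deriv x)"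
      by (simp add: K_def)
    finally show ?thesis .
  qed
  ultimately show ?thesis
    using that by blast
qed

end

section \<open>Convergence of greedy descent\<close>

locale greedy_descent = spanning_cone_form +
  fixes u :: "nat \<Rightarrow> 'a" and C :: real
  assumes unit: "norm (u n) = 1"
    and C_nonneg: "0 \<le> C"
    and descent: "descent_step C (u n) (u (Suc n))"
begin

definition val :: "nat \<Rightarrow> real" where
  "val n = u n \<bullet> A (u n)"

lemma val_decreasing: "val (Suc n) \<le> val n"
  using descent[of n] by (simp add: descent_step_def val_def)

lemma step_le: "norm (u (Suc n) - u n) \<le> C * sqrt (val n - val (Suc n))"
  using descent[of n] by (simp add: descent_step_def val_def)

lemma residual_le:
  "z \<in> S \<Longrightarrow> \<bar>(A (u n) - val n *\<^sub>R u n) \<bullet> z\<bar> \<le> C * sqrt (val n - val (Suc n)) * norm z"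
  using descent[of n] by (simp add: descent_step_def val_def)

lemma convergent_val: "convergent val"
proof -
  have "decseq val"
    using val_decreasing by (simp add: decseq_Suc_iff)
  moreover have "1 - \<nu> \<le> val n" for n
    using coercive[of "u n"] unit[of n] by (simp add: val_def)
  ultimately obtain L where "val \<longlonglongrightarrow> L"
    using decseq_convergent by blast
  thus ?thesis
    by (rule convergentI)
qed

lemma val_gap_tendsto_0: "(\<lambda>n. sqrt (val n - val (Suc n))) \<longlonglongrightarrow> 0"
proof -
  have "val \<longlonglongrightarrow> lim val"
    using convergent_val by (simp add: convergent_LIMSEQ_iff)
  from tendsto_real_sqrt[OF tendsto_diff[OF this LIMSEQ_Suc[OF this]]] show ?thesis
    by simp
qed

text \<open>The gaps of the convergent sequence \<open>val\<close> tend to 0, so the residual tested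
  on each element of \<open>S\<close> vanishes in the limit; a vector orthogonal to a spanning set
  is 0.\<close>

lemma limit_point_eigenvector:
  assumes "strict_mono r" "(u \<circ> r) \<longlonglongrightarrow> w"
  shows "w \<in> unit_eigenvectors (lim val)"
proof -
  have val: "(val \<circ> r) \<longlonglongrightarrow> lim val"
    using convergent_val assms(1) by (intro LIMSEQ_subseq_LIMSEQ) (auto simp: convergent_LIMSEQ_iff)
  have "norm w = 1"
    using tendsto_norm[OF assms(2)] unit by (simp add: LIMSEQ_const_iff comp_def)
  define x where "x = A w - lim val *\<^sub>R w"
  have "\<bar>x \<bullet> z\<bar> \<le> 0 * norm z" if "z \<in> S" for z
  proof (rule tendsto_le)
    show "(\<lambda>n. \<bar>(A ((u \<circ> r) n) - (val \<circ> r) n *\<^sub>R (u \<circ> r) n) \<bullet> z\<bar>) \<longlonglongrightarrow> \<bar>x \<bullet> z\<bar>"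
      unfolding x_def by (intro tendsto_intros assms val)
    have "((\<lambda>n. sqrt (val n - val (Suc n))) \<circ> r) \<longlonglongrightarrow> 0"
      using val_gap_tendsto_0 assms(1) by (rule LIMSEQ_subseq_LIMSEQ)
    hence "(\<lambda>n. C * ((\<lambda>n. sqrt (val n - val (Suc n))) \<circ> r) n * norm z) \<longlonglongrightarrow> C * 0 * norm z"
      by (intro tendsto_intros)
    thus "(\<lambda>n. C * sqrt (val (r n) - val (Suc (r n))) * norm z) \<longlonglongrightarrow> 0 * norm z"
      by (simp add: comp_def)
    show "\<forall>\<^sub>F n in sequentially. \<bar>(A ((u \<circ> r) n) - (val \<circ> r) n *\<^sub>R (u \<circ> r) n) \<bullet> z\<bar>
        \<le> C * sqrt (val (r n) - val (Suc (r n))) * norm z"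
      using residual_le[OF that] by simp
  qed simp
  hence "norm x \<le> 0"
    using span_bound by (metis mult_zero_right order_refl)
  thus ?thesis
    using \<open>norm w = 1\<close> by (simp add: x_def unit_eigenvectors_def)
qed

lemma convergent_subseq:
  assumes "strict_mono (r :: nat \<Rightarrow> nat)"
  obtains r' w where "strict_mono r'" "(u \<circ> (r \<circ> r')) \<longlonglongrightarrow> w"
proof -
  have "compact (sphere (0 :: 'a) 1)"
    by simp
  moreover have "\<forall>n. (u \<circ> r) n \<in> sphere 0 1"
    using unit by simp
  ultimately obtain w r' where "strict_mono r'" "((u \<circ> r) \<circ> r') \<longlonglongrightarrow> w"
    unfolding compact_def by blast
  thus ?thesis
    using that by (simp add: comp_assoc)
qed

lemma unit_eigenvectors_nonempty: "unit_eigenvectors (lim val) \<noteq> {}"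
proof -
  obtain r w where "strict_mono r" "(u \<circ> (id \<circ> r)) \<longlonglongrightarrow> w"
    using convergent_subseq[of id] by (auto simp: strict_mono_def)
  thus ?thesis
    using limit_point_eigenvector by fastforce
qed

text \<open>Otherwise a subsequence stays away from the eigenvectors, and compactness of the sphere
  gives it a limit point, which is an eigenvector. This brings the tail into the region where the
  Lojasiewicz inequality is assumed.\<close>

lemma eventually_near_eigenvectors:
  assumes "0 < \<epsilon>"
  shows "\<forall>\<^sub>F n in sequentially. infdist (u n) (unit_eigenvectors (lim val)) \<le> \<epsilon>"
proof (rule ccontr)
  let ?F = "unit_eigenvectors (lim val)"
  assume "\<not> ?thesis"
  hence "\<exists>\<^sub>F n in sequentially. \<not> infdist (u n) ?F \<le> \<epsilon>"
    by (simp add: not_eventually)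
  then obtain r :: "nat \<Rightarrow> nat" where r: "strict_mono r" "\<And>n. \<not> infdist (u (r n)) ?F \<le> \<epsilon>"
    using infinite_enumerate[of "{n. \<not> infdist (u n) ?F \<le> \<epsilon>}"]
    unfolding frequently_cofinite[symmetric] cofinite_eq_sequentially by auto
  obtain r' w where r': "strict_mono r'" "(u \<circ> (r \<circ> r')) \<longlonglongrightarrow> w"
    using convergent_subseq[OF r(1)] .
  have "w \<in> ?F"
    using r' r(1) by (intro limit_point_eigenvector[of "r \<circ> r'"] strict_mono_o)
  have "\<forall>\<^sub>F n in sequentially. dist ((u \<circ> (r \<circ> r')) n) w < \<epsilon>"
    using r'(2) assms by (rule tendstoD)
  then obtain n where "dist (u (r (r' n))) w < \<epsilon>"
    using eventually_happens by force
  hence "infdist (u (r (r' n))) ?F \<le> \<epsilon>"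
    using infdist_le2[OF \<open>w \<in> ?F\<close>] by (metis less_imp_le)
  thus False
    using r(2) by blast
qed

lemma Lojasiewicz_convergence:
  assumes \<theta>: "0 < \<theta>" "\<theta> \<le> 1 / 2" and "0 \<le> K" "0 < \<epsilon>"
    and loj: "\<And>x. 1/2 < norm x \<Longrightarrow> norm x < 3/2 \<Longrightarrow>
      infdist x (unit_eigenvectors (lim val)) \<le> \<epsilon> \<Longrightarrow>
      \<bar>rq x - lim val\<bar> powr (1 - \<theta>) \<le> K * dual_norm (rq_deriv x)"
  obtains w where "w \<in> unit_eigenvectors (lim val)" "u \<longlonglongrightarrow> w"
    "\<theta> = 1 / 2 \<Longrightarrow> \<exists>D \<sigma>. 0 \<le> D \<and> 0 < \<sigma> \<and> \<sigma> < 1 \<and> (\<forall>n. norm (u n - w) \<le> D * \<sigma> ^ n)"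
    "\<theta> < 1 / 2 \<Longrightarrow> \<exists>D\<ge>0. \<forall>n\<ge>1. norm (u n - w) \<le> D * real n powr (- (\<theta> / (1 - 2 * \<theta>)))"
proof -
  define e where "e n = val n - lim val" for n
  have val: "val \<longlonglongrightarrow> lim val"
    using convergent_val by (simp add: convergent_LIMSEQ_iff)
  have e0: "e \<longlonglongrightarrow> 0"
    unfolding e_def using val by (simp add: LIM_zero)
  have diff: "e n - e (Suc n) = val n - val (Suc n)" for n
    by (simp add: e_def)
  obtain N where N: "\<And>n. n \<ge> N \<Longrightarrow> infdist (u n) (unit_eigenvectors (lim val)) \<le> \<epsilon>"
    using eventually_near_eigenvectors[OF \<open>0 < \<epsilon>\<close>] by (auto simp: eventually_sequentially)
  \<comment> \<open>On the unit sphere \<open>rq_deriv\<close> is twice the tested residual, hence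
    the factor 2.\<close>
  have "e n powr (1 - \<theta>) \<le> K * (2 * C) * sqrt (e n - e (Suc n))" if "n \<ge> N" for n
  proof -
    have "e n \<ge> 0"
      unfolding e_def using decseq_ge[OF _ val] val_decreasing by (simp add: decseq_Suc_iff)
    have rq: "rq (u n) = val n"
      using unit[of n] by (simp add: rq_def val_def)
    have "e n powr (1 - \<theta>) \<le> K * dual_norm (rq_deriv (u n))"
      using loj[of "u n"] unit[of n] N[OF that] \<open>e n \<ge> 0\<close> by (simp add: rq e_def)
    also have "dual_norm (rq_deriv (u n)) \<le> 2 * C * sqrt (val n - val (Suc n))"
    proof (rule dual_norm_le)
      show "0 \<le> 2 * C * sqrt (val n - val (Suc n))"
        using C_nonneg val_decreasing[of n] by simp
      show "rq_deriv (u n) z \<le> 2 * C * sqrt (val n - val (Suc n)) * norm z" if "z \<in> S" for z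
        using residual_le[OF that, of n] unit[of n] by (simp add: rq_deriv_def rq)
    qed
    finally show ?thesis
      using \<open>0 \<le> K\<close> by (simp add: diff mult_left_mono)
  qed
  moreover have "e (Suc n) \<le> e n" for n
    using val_decreasing by (simp add: e_def)
  moreover have "norm (u (Suc n) - u n) \<le> C * sqrt (e n - e (Suc n))" for n
    unfolding diff by (rule step_le)
  moreover have "0 \<le> K * (2 * C)"
    using \<open>0 \<le> K\<close> C_nonneg by simp
  ultimately obtain w where w: "u \<longlonglongrightarrow> w"
    "\<theta> = 1 / 2 \<Longrightarrow> \<exists>D \<sigma>. 0 \<le> D \<and> 0 < \<sigma> \<and> \<sigma> < 1 \<and> (\<forall>n. norm (u n - w) \<le> D * \<sigma> ^ n)"
    "\<theta> < 1 / 2 \<Longrightarrow> \<exists>D\<ge>0. \<forall>n\<ge>1. norm (u n - w) \<le> D * real n powr (- (\<theta> / (1 - 2 * \<theta>)))"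
    using Lojasiewicz_descent_rates[of e \<theta> u C N "K * (2 * C)", OF e0 _ \<theta> _ C_nonneg] by metis
  have "w \<in> unit_eigenvectors (lim val)"
    using limit_point_eigenvector[of id w] w(1) by (simp add: strict_mono_def)
  thus ?thesis
    using that w by blast
qed

end

section \<open>Transfer along the embedding\<close>

locale dictionary_form =
  fixes \<iota> :: "'v::euclidean_space \<Rightarrow> 'h::euclidean_space"
    and a :: "'v \<Rightarrow> 'v \<Rightarrow> real"
    and \<nu> :: real
    and \<Sigma> :: "'v set"
  assumes embedding: "dense_embedding \<iota>"
    and bilinear_a: "bilinear a"
    and symmetric_a: "a v w = a w v"
    and energy_norm_ge: "norm (\<iota> v) \<le> energy_norm a \<iota> \<nu> v"
    and dict: "dictionary \<Sigma>"
begin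

section \<open>The inverse embedding and the operator of the form\<close>

lemma linear_embedding: "linear \<iota>"
  using embedding by (simp add: dense_embedding_def linear_conv_bounded_linear)

text \<open>The range is a subspace of a finite-dimensional space, hence closed; being dense, it is
  everything.\<close>

lemma bij_embedding: "bij \<iota>"
proof -
  have "closed (range \<iota>)"
    using linear_embedding by (intro closed_subspace linear_subspace_image) auto
  thus ?thesis
    using embedding by (simp add: dense_embedding_def bij_def)
qed

definition \<kappa> :: "'h \<Rightarrow> 'v" where "\<kappa> = inv \<iota>"

lemma \<iota>_\<kappa> [simp]: "\<iota> (\<kappa> x) = x" and \<kappa>_\<iota> [simp]: "\<kappa> (\<iota> v) = v"
  using bij_embedding by (simp_all add: \<kappa>_def bij_is_surj bij_is_inj surj_f_inv_f)

lemma \<iota>_simps [simp]: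
  "\<iota> (v + w) = \<iota> v + \<iota> w" "\<iota> (v - w) = \<iota> v - \<iota> w" "\<iota> (t *\<^sub>R v) = t *\<^sub>R \<iota> v" "\<iota> 0 = 0"
  by (simp_all only: linear_add[OF linear_embedding] linear_diff[OF linear_embedding]
      linear_cmul[OF linear_embedding] linear_0[OF linear_embedding])

lemma \<iota>_eq_0 [simp]: "\<iota> v = 0 \<longleftrightarrow> v = 0"
proof
  assume "\<iota> v = 0"
  hence "\<kappa> (\<iota> v) = \<kappa> (\<iota> 0)"
    by simp
  thus "v = 0"
    by (simp only: \<kappa>_\<iota>)
qed simp

lemma linear_\<kappa>: "linear \<kappa>"
proof (rule linearI)
  show "\<kappa> (x + y) = \<kappa> x + \<kappa> y" for x y
    by (metis \<iota>_\<kappa> \<kappa>_\<iota> \<iota>_simps(1))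
  show "\<kappa> (t *\<^sub>R x) = t *\<^sub>R \<kappa> x" for t x
    by (metis \<iota>_\<kappa> \<kappa>_\<iota> \<iota>_simps(3))
qed

text \<open>Riesz representation of the form, by its coordinates in the orthonormal basis of
  \<open>H\<close>.\<close>

definition A :: "'h \<Rightarrow> 'h" where
  "A y = (\<Sum>b\<in>Basis. a (\<kappa> b) (\<kappa> y) *\<^sub>R b)"

lemma inner_A: "x \<bullet> A y = a (\<kappa> x) (\<kappa> y)"
proof -
  have lin: "linear (\<lambda>x. a (\<kappa> x) (\<kappa> y))"
    using linear_compose[OF linear_\<kappa>, of "\<lambda>v. a v (\<kappa> y)"] bilinear_a by (simp add: bilinear_def comp_def)
  have "a (\<kappa> x) (\<kappa> y) = a (\<kappa> (\<Sum>b\<in>Basis. (x \<bullet> b) *\<^sub>R b)) (\<kappa> y)"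
    by (simp add: euclidean_representation)
  also have "\<dots> = (\<Sum>b\<in>Basis. (x \<bullet> b) * a (\<kappa> b) (\<kappa> y))"
    using linear_sum[OF lin, of "\<lambda>b. (x \<bullet> b) *\<^sub>R b" Basis] linear_cmul[OF lin] by simp
  finally show ?thesis
    by (simp add: A_def inner_sum_right mult.commute)
qed

lemma a_eq: "a v w = \<iota> v \<bullet> A (\<iota> w)"
  by (simp add: inner_A)

lemma energy_norm_sq: "energy_inner a \<iota> \<nu> v v = \<iota> v \<bullet> A (\<iota> v) + \<nu> * (norm (\<iota> v))\<^sup>2"
  by (simp add: energy_inner_def a_eq power2_norm_eq_inner)

sublocale spanning_cone_form A \<nu> "\<iota> ` \<Sigma>"
proof (rule spanning_cone_form.intro)
  have linr: "linear (\<lambda>y. a (\<kappa> x) (\<kappa> y))" for x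
    using linear_compose[OF linear_\<kappa>, of "\<lambda>v. a (\<kappa> x) v"] bilinear_a by (simp add: bilinear_def comp_def)
  show "linear A"
  proof (rule linearI)
    show "A (x + y) = A x + A y" for x y
      using linear_add[OF linr] by (subst vector_eq_ldot[symmetric]) (simp add: inner_add_right inner_A)
    show "A (t *\<^sub>R x) = t *\<^sub>R A x" for t x
      using linear_cmul[OF linr] by (subst vector_eq_ldot[symmetric]) (simp add: inner_A)
  qed
  show "A x \<bullet> y = x \<bullet> A y" for x y
    using symmetric_a by (simp add: inner_A inner_commute[of "A x"])
  show "(norm x)\<^sup>2 \<le> x \<bullet> A x + \<nu> * (norm x)\<^sup>2" for x
  proof -
    have "norm x \<le> sqrt (x \<bullet> A x + \<nu> * (norm x)\<^sup>2)"
      using energy_norm_ge[of "\<kappa> x"] by (simp add: energy_norm_def energy_norm_sq)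
    \<comment> \<open>The real \<open>sqrt\<close> has the sign of its argument, so a nonnegative
      root certifies a nonnegative radicand and the inequality may be squared.\<close>
    moreover from this have "0 \<le> sqrt (x \<bullet> A x + \<nu> * (norm x)\<^sup>2)"
      using norm_ge_zero order_trans by blast
    ultimately show ?thesis
      using power_mono[OF _ norm_ge_zero, of x _ 2] by (metis real_sqrt_ge_0_iff real_sqrt_pow2)
  qed
  show "t *\<^sub>R z \<in> \<iota> ` \<Sigma>" if "z \<in> \<iota> ` \<Sigma>" for z t
  proof -
    obtain v where "v \<in> \<Sigma>" "z = \<iota> v"
      using \<open>z \<in> \<iota> ` \<Sigma>\<close> by blast
    hence "\<iota> (t *\<^sub>R v) \<in> \<iota> ` \<Sigma>"
      using dict unfolding dictionary_def by blast
    thus ?thesis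
      using \<open>z = \<iota> v\<close> by simp
  qed
  have "span \<Sigma> = UNIV"
    using dict by (simp add: dictionary_def closure_closed)
  thus "span (\<iota> ` \<Sigma>) = UNIV"
    using bij_embedding by (simp add: linear_span_image[OF linear_embedding] bij_is_surj)
qed

section \<open>Energy, Rayleigh quotient and eigenvectors read on \<open>H\<close>\<close>

lemma energy_norm_eq: "energy_norm a \<iota> \<nu> v = sqrt (energy (\<iota> v))"
  by (simp add: energy_norm_def energy_norm_sq energy_def)

lemma rayleigh_quotient_eq: "rayleigh_quotient a \<iota> v = rq (\<iota> v)"
  by (simp add: rayleigh_quotient_def rq_def a_eq)

lemma rayleigh_eq: "rayleigh a \<iota> v = (if v = 0 then \<infinity> else ereal (rq (\<iota> v)))"
  by (simp add: rayleigh_def rayleigh_quotient_eq)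

text \<open>Quotient rule; selfadjointness merges the two halves of the derivative of the quadratic
  form into the factor 2 of \<open>rq_deriv\<close>.\<close>

lemma rayleigh_deriv_eq:
  assumes "v \<noteq> 0"
  shows "rayleigh_deriv a \<iota> v z = rq_deriv (\<iota> v) (\<iota> z)"
proof -
  have D: "(\<iota> has_derivative \<iota>) (at v)" "((\<lambda>v. A (\<iota> v)) has_derivative (\<lambda>h. A (\<iota> h))) (at v)"
    using linear_embedding linear_compose[OF linear_embedding linear_A]
    by (auto simp: linear_conv_bounded_linear comp_def intro: bounded_linear_imp_has_derivative)
  define D' where "D' h =
      ((\<iota> v \<bullet> A (\<iota> h) + \<iota> h \<bullet> A (\<iota> v)) * (\<iota> v \<bullet> \<iota> v) -
       \<iota> v \<bullet> A (\<iota> v) * (\<iota> v \<bullet> \<iota> h + \<iota> h \<bullet> \<iota> v)) / ((\<iota> v \<bullet> \<iota> v) * (\<iota> v \<bullet> \<iota> v))" for h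
  have "(rayleigh_quotient a \<iota> has_derivative D') (at v)"
    unfolding rayleigh_quotient_eq[abs_def] rq_def power2_norm_eq_inner D'_def
    using assms by (intro has_derivative_divide' has_derivative_inner D) simp
  hence "rayleigh_deriv a \<iota> v = D'"
    unfolding rayleigh_deriv_def by (rule frechet_derivative_at[symmetric])
  hence "rayleigh_deriv a \<iota> v z = D' z"
    by (rule fun_cong)
  also have "\<dots> = rq_deriv (\<iota> v) (\<iota> z)"
  proof -
    have "\<iota> v \<bullet> A (\<iota> z) = A (\<iota> v) \<bullet> \<iota> z" "\<iota> z \<bullet> A (\<iota> v) = A (\<iota> v) \<bullet> \<iota> z" "\<iota> z \<bullet> \<iota> v = \<iota> v \<bullet> \<iota> z"
      by (simp_all only: selfadjoint inner_commute[of "\<iota> z" "A (\<iota> v)"] inner_commute[of "\<iota> z" "\<iota> v"])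
    moreover have "\<iota> v \<bullet> \<iota> v \<noteq> 0"
      using assms by simp
    ultimately show ?thesis
      unfolding D'_def rq_deriv_def rq_def power2_norm_eq_inner
      by (simp add: inner_diff_left field_simps)
  qed
  finally show ?thesis .
qed

lemma injective_norm_eq:
  assumes "v \<noteq> 0"
  shows "injective_norm a \<iota> \<nu> \<Sigma> (rayleigh_deriv a \<iota> v) = dual_norm (rq_deriv (\<iota> v))"
proof -
  have "\<iota> ` \<Sigma> - {0} = \<iota> ` (\<Sigma> - {0})"
    by auto
  thus ?thesis
    using assms by (simp add: injective_norm_def dual_norm_def image_image energy_norm_eq rayleigh_deriv_eq)
qed

lemma is_eigenvector_iff: "is_eigenvector a \<iota> \<mu> v \<longleftrightarrow> v \<noteq> 0 \<and> A (\<iota> v) = \<mu> *\<^sub>R \<iota> v"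
proof -
  have "(\<forall>w. a v w = \<mu> * (\<iota> v \<bullet> \<iota> w)) \<longleftrightarrow> (\<forall>x. x \<bullet> A (\<iota> v) = x \<bullet> (\<mu> *\<^sub>R \<iota> v))"
  proof safe
    fix x assume "\<forall>w. a v w = \<mu> * (\<iota> v \<bullet> \<iota> w)"
    from this[rule_format, of "\<kappa> x"] show "x \<bullet> A (\<iota> v) = x \<bullet> (\<mu> *\<^sub>R \<iota> v)"
      using symmetric_a by (simp add: inner_A inner_commute)
  next
    fix w assume "\<forall>x. x \<bullet> A (\<iota> v) = x \<bullet> (\<mu> *\<^sub>R \<iota> v)"
    from this[rule_format, of "\<iota> w"] show "a v w = \<mu> * (\<iota> v \<bullet> \<iota> w)"
      using symmetric_a by (simp add: inner_A inner_commute)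
  qed
  thus ?thesis
    by (simp only: is_eigenvector_def vector_eq_ldot)
qed

lemma image_normalized_eigenvectors:
  "\<iota> ` normalized_eigenvectors a \<iota> \<mu> = unit_eigenvectors \<mu>"
proof -
  have iff: "v \<in> normalized_eigenvectors a \<iota> \<mu> \<longleftrightarrow> \<iota> v \<in> unit_eigenvectors \<mu>" for v
    by (auto simp: normalized_eigenvectors_def unit_eigenvectors_def is_eigenvector_iff)
  show ?thesis
  proof (intro set_eqI iffI)
    fix x assume "x \<in> unit_eigenvectors \<mu>"
    hence "\<kappa> x \<in> normalized_eigenvectors a \<iota> \<mu>"
      by (simp add: iff)
    thus "x \<in> \<iota> ` normalized_eigenvectors a \<iota> \<mu>"
      using imageI[of "\<kappa> x" _ \<iota>] by simp
  qed (auto simp: iff)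
qed

text \<open>Surjectivity of \<open>\<iota>\<close> lets the quantifier range over \<open>H\<close>.
  For a nonempty set \<open>infdist\<close> is the infimum in question; for the empty set it has the
  default value 0. The lower bound 1/2 on the norm excludes \<open>v = 0\<close>, where the
  derivative formula does not apply.\<close>

lemma lojasiewicz_iff:
  assumes "unit_eigenvectors \<mu> \<noteq> {}"
  shows "lojasiewicz a \<iota> \<nu> \<Sigma> \<mu> K \<theta> \<epsilon> \<longleftrightarrow>
    (\<forall>x. 1/2 < norm x \<and> norm x < 3/2 \<and> infdist x (unit_eigenvectors \<mu>) \<le> \<epsilon> \<longrightarrow>
      \<bar>rq x - \<mu>\<bar> powr (1 - \<theta>) \<le> K * dual_norm (rq_deriv x))"
    (is "_ \<longleftrightarrow> (\<forall>x. ?P x)")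
proof -
  have "(INF w\<in>normalized_eigenvectors a \<iota> \<mu>. norm (\<iota> v - \<iota> w)) = infdist (\<iota> v) (unit_eigenvectors \<mu>)" for v
    using assms by (simp add: infdist_def dist_norm image_image flip: image_normalized_eigenvectors)
  moreover have "injective_norm a \<iota> \<nu> \<Sigma> (rayleigh_deriv a \<iota> v) = dual_norm (rq_deriv (\<iota> v))"
    if "1/2 < norm (\<iota> v)" for v
    using that by (intro injective_norm_eq) auto
  ultimately have "lojasiewicz a \<iota> \<nu> \<Sigma> \<mu> K \<theta> \<epsilon> \<longleftrightarrow> (\<forall>v. ?P (\<iota> v))"
    unfolding lojasiewicz_def rayleigh_quotient_eq by (intro all_cong1) auto
  also have "\<dots> \<longleftrightarrow> (\<forall>x. ?P x)"
    by (metis \<iota>_\<kappa>)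
  finally show ?thesis .
qed

lemma PRaGA_descent:
  assumes "PRaGA a \<iota> \<Sigma> u lam"
  obtains C where "0 \<le> C"
    "\<And>n. norm (\<iota> (u n)) = 1" "\<And>n. descent_step C (\<iota> (u n)) (\<iota> (u (Suc n)))"
proof -
  have u0: "norm (\<iota> (u 0)) = 1" and lam: "\<And>n. lam n = a (u n) (u n)"
    and inf: "ereal (lam 0) < dictionary_inf a \<iota> \<Sigma>"
    and step: "\<And>n. \<exists>z. is_arg_min (\<lambda>z. rayleigh a \<iota> (u n + z)) (\<lambda>z. z \<in> \<Sigma>) z \<and>
              u (Suc n) = (u n + z) /\<^sub>R norm (\<iota> (u n + z))"
    using assms unfolding PRaGA_def by blast+
  \<comment> \<open>A real number strictly between the initial value and the possibly infinite
    \<open>dictionary_inf\<close>; it provides the gap for every step at once.\<close>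
  obtain d where d: "lam 0 < d" "ereal d < dictionary_inf a \<iota> \<Sigma>"
    using ereal_dense2[OF inf] by auto
  have d_le: "d \<le> rq y" if y: "y \<in> \<iota> ` \<Sigma>" "y \<noteq> 0" for y
  proof -
    obtain z where z: "z \<in> \<Sigma> - {0}" "y = \<iota> z"
      using y by auto
    hence "dictionary_inf a \<iota> \<Sigma> \<le> rayleigh a \<iota> z"
      unfolding dictionary_inf_def by (intro INF_lower)
    with d(2) have "ereal d < rayleigh a \<iota> z"
      by (rule less_le_trans)
    thus ?thesis
      using z by (simp add: rayleigh_eq)
  qed
  obtain C where C: "0 \<le> C"
    "\<And>u z. norm u = 1 \<Longrightarrow> u \<bullet> A u \<le> lam 0 \<Longrightarrow> z \<in> \<iota> ` \<Sigma> \<Longrightarrow> u + z \<noteq> 0 \<Longrightarrow>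
      \<forall>y\<in>\<iota> ` \<Sigma>. u + y \<noteq> 0 \<longrightarrow> rq (u + z) \<le> rq (u + y) \<Longrightarrow>
      descent_step C u (sgn (u + z))"
    using Rayleigh_greedy_descent[OF d(1)] d_le by metis
  have one_step: "norm (\<iota> (u (Suc n))) = 1 \<and> descent_step C (\<iota> (u n)) (\<iota> (u (Suc n)))"
    if n: "norm (\<iota> (u n)) = 1" "\<iota> (u n) \<bullet> A (\<iota> (u n)) \<le> lam 0" for n
  proof -
    obtain z where z: "z \<in> \<Sigma>" "u (Suc n) = (u n + z) /\<^sub>R norm (\<iota> (u n + z))"
      and min: "\<And>y. y \<in> \<Sigma> \<Longrightarrow> rayleigh a \<iota> (u n + z) \<le> rayleigh a \<iota> (u n + y)"
      using step[of n] by (auto simp: is_arg_min_def not_less)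
    have "u n \<noteq> 0"
      using n(1) by auto
    \<comment> \<open>The competitor 0 has a finite value, so the minimiser cannot reach the value
      \<infinity> at the origin.\<close>
    hence "u n + z \<noteq> 0"
      using min[of 0] dict by (auto simp: rayleigh_eq dictionary_def)
    hence nz: "\<iota> (u n) + \<iota> z \<noteq> 0"
      by (metis \<iota>_eq_0 \<iota>_simps(1))
    have "rq (\<iota> (u n) + \<iota> z) \<le> rq (\<iota> (u n) + y)" if y: "y \<in> \<iota> ` \<Sigma>" "\<iota> (u n) + y \<noteq> 0" for y
    proof -
      obtain v where "v \<in> \<Sigma>" "y = \<iota> v"
        using y(1) by auto
      moreover from this have "u n + v \<noteq> 0"
        using y(2) by (metis \<iota>_eq_0 \<iota>_simps(1))
      ultimately show ?thesis
        using min[of v] \<open>u n + z \<noteq> 0\<close> by (simp add: rayleigh_eq)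
    qed
    moreover have "\<iota> (u (Suc n)) = sgn (\<iota> (u n) + \<iota> z)"
      using z(2) by (simp add: sgn_div_norm)
    ultimately show ?thesis
      using C(2)[OF n, of "\<iota> z"] z(1) nz by (simp add: norm_sgn)
  qed
  \<comment> \<open>The level bound is carried along because the uniform gap is measured from
    \<open>lam 0\<close>.\<close>
  have inv: "norm (\<iota> (u n)) = 1 \<and> \<iota> (u n) \<bullet> A (\<iota> (u n)) \<le> lam 0" for n
  proof (induction n)
    case 0
    show ?case using u0 lam by (simp add: inner_A)
  next
    case (Suc n)
    thus ?case
      using one_step[of n] by (auto simp: descent_step_def)
  qed
  show ?thesis
    using that[of C] C(1) inv one_step by blast
qed

lemma PReGA_descent:
  assumes "PReGA a \<iota> \<nu> \<Sigma> u lam"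
  obtains C where "0 \<le> C"
    "\<And>n. norm (\<iota> (u n)) = 1" "\<And>n. descent_step C (\<iota> (u n)) (\<iota> (u (Suc n)))"
proof -
  have u0: "norm (\<iota> (u 0)) = 1" and lam: "\<And>n. lam n = a (u n) (u n)"
    and step: "\<And>n. \<exists>z. is_arg_min
                (\<lambda>z. 1/2 * (energy_norm a \<iota> \<nu> (u n + z))\<^sup>2 - (lam n + \<nu>) * (\<iota> (u n) \<bullet> \<iota> z))
                (\<lambda>z. z \<in> \<Sigma>) z \<and>
              u (Suc n) = (u n + z) /\<^sub>R norm (\<iota> (u n + z))"
    using assms unfolding PReGA_def by blast+
  obtain C where C: "0 \<le> C"
    "\<And>u z. norm u = 1 \<Longrightarrow> z \<in> \<iota> ` \<Sigma> \<Longrightarrow>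
      (\<And>y. y \<in> \<iota> ` \<Sigma> \<Longrightarrow> 1/2 * energy (u + z) - (u \<bullet> A u + \<nu>) * (u \<bullet> z)
              \<le> 1/2 * energy (u + y) - (u \<bullet> A u + \<nu>) * (u \<bullet> y)) \<Longrightarrow>
      u + z \<noteq> 0 \<and> descent_step C u (sgn (u + z))"
    using residual_greedy_descent by blast
  have sq: "(energy_norm a \<iota> \<nu> v)\<^sup>2 = energy (\<iota> v)" for v
  proof -
    have "0 \<le> energy (\<iota> v)"
      using coercive[of "\<iota> v"] unfolding energy_def by (rule order_trans[OF zero_le_power2])
    thus ?thesis
      by (simp add: energy_norm_eq)
  qed
  have one_step: "norm (\<iota> (u (Suc n))) = 1 \<and> descent_step C (\<iota> (u n)) (\<iota> (u (Suc n)))"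
    if n: "norm (\<iota> (u n)) = 1" for n
  proof -
    obtain z where z: "z \<in> \<Sigma>" "u (Suc n) = (u n + z) /\<^sub>R norm (\<iota> (u n + z))"
      and min: "\<And>y. y \<in> \<Sigma> \<Longrightarrow>
        1/2 * (energy_norm a \<iota> \<nu> (u n + z))\<^sup>2 - (lam n + \<nu>) * (\<iota> (u n) \<bullet> \<iota> z)
        \<le> 1/2 * (energy_norm a \<iota> \<nu> (u n + y))\<^sup>2 - (lam n + \<nu>) * (\<iota> (u n) \<bullet> \<iota> y)"
      using step[of n] by (auto simp: is_arg_min_def not_less)
    have lam': "lam n = \<iota> (u n) \<bullet> A (\<iota> (u n))"
      by (simp add: lam inner_A)
    have "\<iota> (u n) + \<iota> z \<noteq> 0 \<and> descent_step C (\<iota> (u n)) (sgn (\<iota> (u n) + \<iota> z))"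
    proof (rule C(2)[OF n])
      show "\<iota> z \<in> \<iota> ` \<Sigma>"
        using z(1) by simp
      show "1/2 * energy (\<iota> (u n) + \<iota> z) - (\<iota> (u n) \<bullet> A (\<iota> (u n)) + \<nu>) * (\<iota> (u n) \<bullet> \<iota> z)
          \<le> 1/2 * energy (\<iota> (u n) + y) - (\<iota> (u n) \<bullet> A (\<iota> (u n)) + \<nu>) * (\<iota> (u n) \<bullet> y)"
        if y: "y \<in> \<iota> ` \<Sigma>" for y
        using min y unfolding sq lam' by auto
    qed
    moreover have "\<iota> (u (Suc n)) = sgn (\<iota> (u n) + \<iota> z)"
      using z(2) by (simp add: sgn_div_norm)
    ultimately show ?thesis
      by (simp add: norm_sgn)
  qed
  have "norm (\<iota> (u n)) = 1" for n
    using u0 one_step by (induction n) auto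
  thus ?thesis
    using that[of C] C(1) one_step by blast
qed

end

theorem theorem3p2:
  fixes \<iota> :: "'v::euclidean_space \<Rightarrow> 'h::euclidean_space"
    and a :: "'v \<Rightarrow> 'v \<Rightarrow> real"
    and \<gamma> \<nu> \<mu> :: real
    and \<Sigma> :: "'v set"
    and u :: "nat \<Rightarrow> 'v"
    and lam :: "nat \<Rightarrow> real"
  assumes "dense_embedding \<iota>"
    and "bilinear a"
    and "\<And>v w. a v w = a w v"
    and "\<gamma> > 0" and "\<nu> > 0"
    and "\<And>v. a v v \<ge> \<gamma> * (norm v)\<^sup>2 - \<nu> * (norm (\<iota> v))\<^sup>2"
    and "\<And>v. energy_norm a \<iota> \<nu> v \<ge> norm (\<iota> v)"
    and "dictionary \<Sigma>"
    and "PRaGA a \<iota> \<Sigma> u lam \<or> PReGA a \<iota> \<nu> \<Sigma> u lam"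
    and "\<mu> = lim lam"
  shows "convergent lam \<and> is_eigenvalue a \<iota> \<mu> \<and>
    (\<exists>K \<theta> \<epsilon>. K \<ge> 0 \<and> 0 < \<theta> \<and> \<theta> \<le> 1/2 \<and> \<epsilon> > 0 \<and> lojasiewicz a \<iota> \<nu> \<Sigma> \<mu> K \<theta> \<epsilon>) \<and>
    (\<forall>K \<theta> \<epsilon>. K \<ge> 0 \<and> 0 < \<theta> \<and> \<theta> \<le> 1/2 \<and> \<epsilon> > 0 \<and> lojasiewicz a \<iota> \<nu> \<Sigma> \<mu> K \<theta> \<epsilon> \<longrightarrow>
       (\<exists>w \<in> normalized_eigenvectors a \<iota> \<mu>.
          u \<longlonglongrightarrow> w \<and>
          (\<theta> = 1/2 \<longrightarrow>
             (\<exists>C \<sigma>. C \<ge> 0 \<and> 0 < \<sigma> \<and> \<sigma> < 1 \<and>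
                (\<forall>n. energy_norm a \<iota> \<nu> (u n - w) \<le> C * \<sigma> ^ n))) \<and>
          (\<theta> < 1/2 \<longrightarrow>
             (\<exists>C \<ge> 0. \<forall>n \<ge> 1.
                energy_norm a \<iota> \<nu> (u n - w) \<le> C * real n powr (- (\<theta> / (1 - 2 * \<theta>)))))))"
proof -
  interpret dictionary_form \<iota> a \<nu> \<Sigma>
    using assms by unfold_locales auto
  obtain C where C: "0 \<le> C" "\<And>n. norm (\<iota> (u n)) = 1"
    "\<And>n. descent_step C (\<iota> (u n)) (\<iota> (u (Suc n)))"
    using assms(9) PRaGA_descent PReGA_descent by metis
  interpret greedy_descent A \<nu> "\<iota> ` \<Sigma>" "\<lambda>n. \<iota> (u n)" C
    using C by unfold_locales auto
  have "lam n = a (u n) (u n)" for n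
    using assms(9) by (auto simp: PRaGA_def PReGA_def)
  hence "val = lam"
    by (simp add: fun_eq_iff val_def inner_A)
  hence \<mu>: "lim val = \<mu>" and "convergent lam"
    using assms(10) convergent_val by auto
  note nonempty = unit_eigenvectors_nonempty[unfolded \<mu>]
  have eigenvalue: "is_eigenvalue a \<iota> \<mu>"
    using nonempty image_normalized_eigenvectors[of \<mu>]
    by (auto simp: is_eigenvalue_def normalized_eigenvectors_def)
  have loj_ex: "\<exists>K \<theta> \<epsilon>. K \<ge> 0 \<and> 0 < \<theta> \<and> \<theta> \<le> 1/2 \<and> \<epsilon> > 0 \<and> lojasiewicz a \<iota> \<nu> \<Sigma> \<mu> K \<theta> \<epsilon>"
  proof -
    obtain K \<epsilon> where "0 \<le> K" "0 < \<epsilon>"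
      and *: "\<And>x. 1/2 < norm x \<Longrightarrow> norm x < 3/2 \<Longrightarrow> infdist x (unit_eigenvectors \<mu>) \<le> \<epsilon> \<Longrightarrow>
        \<bar>rq x - \<mu>\<bar> powr (1 / 2) \<le> K * dual_norm (rq_deriv x)"
      using Lojasiewicz_half[OF nonempty] by blast
    \<comment> \<open>Existence is witnessed by the largest admissible exponent, thanks to the
      quadratic behaviour near the eigenspace.\<close>
    moreover have "lojasiewicz a \<iota> \<nu> \<Sigma> \<mu> K (1 / 2) \<epsilon>"
      unfolding lojasiewicz_iff[OF nonempty] using * by simp
    ultimately show ?thesis
      by (intro exI[of _ K] exI[of _ "1/2"] exI[of _ \<epsilon>]) auto
  qed
  have main: "\<exists>w \<in> normalized_eigenvectors a \<iota> \<mu>.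
          u \<longlonglongrightarrow> w \<and>
          (\<theta> = 1/2 \<longrightarrow>
             (\<exists>C \<sigma>. C \<ge> 0 \<and> 0 < \<sigma> \<and> \<sigma> < 1 \<and>
                (\<forall>n. energy_norm a \<iota> \<nu> (u n - w) \<le> C * \<sigma> ^ n))) \<and>
          (\<theta> < 1/2 \<longrightarrow>
             (\<exists>C \<ge> 0. \<forall>n \<ge> 1.
                energy_norm a \<iota> \<nu> (u n - w) \<le> C * real n powr (- (\<theta> / (1 - 2 * \<theta>)))))"
    if K: "K \<ge> 0" "0 < \<theta>" "\<theta> \<le> 1/2" "\<epsilon> > 0" "lojasiewicz a \<iota> \<nu> \<Sigma> \<mu> K \<theta> \<epsilon>" for K \<theta> \<epsilon>
  proof -
    have "\<And>x. 1/2 < norm x \<Longrightarrow> norm x < 3/2 \<Longrightarrow> infdist x (unit_eigenvectors \<mu>) \<le> \<epsilon> \<Longrightarrow>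
        \<bar>rq x - \<mu>\<bar> powr (1 - \<theta>) \<le> K * dual_norm (rq_deriv x)"
      using K(5) unfolding lojasiewicz_iff[OF nonempty] by blast
    from Lojasiewicz_convergence[unfolded \<mu>, OF K(2,3,1,4) this]
    obtain x where x: "x \<in> unit_eigenvectors \<mu>" "(\<lambda>n. \<iota> (u n)) \<longlonglongrightarrow> x"
      and half: "\<theta> = 1 / 2 \<Longrightarrow> \<exists>D \<sigma>. 0 \<le> D \<and> 0 < \<sigma> \<and> \<sigma> < 1 \<and> (\<forall>n. norm (\<iota> (u n) - x) \<le> D * \<sigma> ^ n)"
      and less: "\<theta> < 1 / 2 \<Longrightarrow>
        \<exists>D\<ge>0. \<forall>n\<ge>1. norm (\<iota> (u n) - x) \<le> D * real n powr (- (\<theta> / (1 - 2 * \<theta>)))"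
      by blast
    obtain w where w: "w \<in> normalized_eigenvectors a \<iota> \<mu>" "x = \<iota> w"
      using x(1) image_normalized_eigenvectors[of \<mu>] by auto
    obtain R where R: "0 < R" "\<And>x. sqrt (energy x) \<le> R * norm x"
      using sqrt_energy_upper by blast
    \<comment> \<open>The energy norm is at most \<open>R\<close> times the norm of
      \<open>H\<close>, so rates transfer with the constant multiplied by \<open>R\<close>.\<close>
    have le: "energy_norm a \<iota> \<nu> (u n - w) \<le> (R * D) * t" if "norm (\<iota> (u n) - x) \<le> D * t" for n D t
    proof -
      have "energy_norm a \<iota> \<nu> (u n - w) \<le> R * norm (\<iota> (u n) - x)"
        using R(2)[of "\<iota> (u n - w)"] by (simp add: energy_norm_eq w(2))
      also have "\<dots> \<le> R * (D * t)"
        using that R(1) by (intro mult_left_mono) auto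
      finally show ?thesis
        by simp
    qed
    \<comment> \<open>Convergence in \<open>V\<close> follows from convergence in \<open>H\<close>
      because the inverse \<open>\<kappa>\<close> is bounded in finite dimension.\<close>
    have "u \<longlonglongrightarrow> w"
      using bounded_linear.tendsto[OF _ x(2), of \<kappa>] linear_\<kappa> by (simp add: w(2) linear_conv_bounded_linear)
    moreover have "\<exists>C \<sigma>. C \<ge> 0 \<and> 0 < \<sigma> \<and> \<sigma> < 1 \<and> (\<forall>n. energy_norm a \<iota> \<nu> (u n - w) \<le> C * \<sigma> ^ n)"
      if "\<theta> = 1/2"
      using half[OF that] le R(1) by (meson less_imp_le mult_nonneg_nonneg)
    moreover have "\<exists>C \<ge> 0. \<forall>n \<ge> 1. energy_norm a \<iota> \<nu> (u n - w) \<le> C * real n powr (- (\<theta> / (1 - 2 * \<theta>)))"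
      if "\<theta> < 1/2"
      using less[OF that] le R(1) by (meson less_imp_le mult_nonneg_nonneg)
    ultimately show ?thesis
      using w(1) by blast
  qed
  show ?thesis
    using \<open>convergent lam\<close> eigenvalue loj_ex main by blast
qed

end
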